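(* For a nonnegative integer $s$, let $MC_n(s)$ denote the number of $n\times n\times n$ magic cubes with magic sum $s$. Then, as a function of $s$, $MC_n(s)$ is a quasipolynomial of degree $(n-1)^3-4$ for every integer $n\ge 3$ with $n\ne 4$, and for $n=4$ it is a quasipolynomial of degree $(4-1)^3-3=24$. For $n=3$, $$\sum_{s=0}^{\infty} MC_3(s)t^s = \frac{t^{12} + 14t^9 + 36t^6 + 14t^3 + 1}{(1-t^3)^5} = 1 + 19t^3 + 121t^6 + 439t^9 + 1171t^{12} + 2581t^{15} + 4999t^{18} + \cdots,$$ and thus, for every integer $s\ge 0$, $$MC_3(s) = \begin{cases} \frac{11}{324}s^4 + \frac{11}{54}s^3 + \frac{25}{36}s^2 + \frac{7}{6}s + 1 & \text{if } 3\mid s, \\ 0 & \text{otherwise.} \end{cases}$$ Moreover, the polytope of stochastic $3\times 3\times 3\times 3$ magic hypercubes is not integral.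
   Context: A semi-magic hypercube is a $d$-dimensional $n \times n \times \cdots \times n$ array $(x_{i_1,\ldots,i_d})_{1\le i_1,\ldots,i_d\le n}$ of $n^d$ nonnegative integers such that the sum of the entries along every line parallel to a coordinate axis (fixing all but one index and summing over the remaining one) is the same number $s$, called the magic sum. A magic hypercube is a semi-magic hypercube for which, in addition, the sums along all $2^{d-1}$ main diagonals are also equal to $s$; the main diagonals are the $2^{d-1}$ copies of the diagonal $x_{1,1,\ldots,1}, x_{2,2,\ldots,2},\ldots,x_{n,n,\ldots,n}$ under the symmetries of the $d$-cube (i.e. obtained by replacing $i$ by $n+1-i$ in some of the coordinates). A magic cube is a magic hypercube with $d=3$ (so there are 4 main diagonals). A function $f:\mathbb{N}\to\mathbb{C}$ is a quasipolynomial if there are an integer $N>0$ and polynomials $f_0,\ldots,f_{N-1}$ such that $f(m)=f_i(m)$ whenever $m\equiv i \pmod N$; its degree is the maximum of the degrees of the $f_i$. The polytope of stochastic $3\times3\times3\times3$ magic hypercubes is the set of all real nonnegative $3\times3\times3\times3$ arrays in $\mathbb{R}^{81}$ all of whose axis-parallel line sums and all 8 main diagonal sums equal $1$. A polytope is integral if all its vertices have integer coordinates. *)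

theory Defs
  imports "HOL-Analysis.Analysis" "HOL-Computational_Algebra.Computational_Algebra"
begin

text \<open>
  An array of dimension \<open>d\<close> and side \<open>n\<close> is a function on multi-indices; a multi-index is a list of
  length \<open>d\<close> with entries in \<open>{1..n}\<close>.  The entries range over any ordered semiring, so that natural
  number arrays (which are counted) and real arrays (which form a polytope) share one definition.
\<close>

definition hc_index :: "nat \<Rightarrow> nat \<Rightarrow> nat list set" where
  "hc_index d n = {v. length v = d \<and> set v \<subseteq> {1..n}}"

definition semi_magic_hypercube ::
    "nat \<Rightarrow> nat \<Rightarrow> 'a::linordered_semidom \<Rightarrow> (nat list \<Rightarrow> 'a) \<Rightarrow> bool" where
  "semi_magic_hypercube d n s x \<longleftrightarrow>
     (\<forall>v\<in>hc_index d n. x v \<ge> 0) \<and>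
     (\<forall>v\<in>hc_index d n. \<forall>k<d. (\<Sum>i=1..n. x (v[k := i])) = s)"

text \<open>
  \<open>diag_index d n R i\<close> is the \<open>i\<close>-th position on the main diagonal obtained from
  \<open>(1,\<dots>,1), \<dots>, (n,\<dots>,n)\<close> by reflecting the coordinates in \<open>R\<close> (coordinates are numbered from 0).
  \<open>R\<close> and its complement give the same diagonal traversed in opposite directions, so the \<open>2 ^ d\<close>
  choices of \<open>R\<close> describe the \<open>2 ^ (d - 1)\<close> main diagonals.
\<close>

definition diag_index :: "nat \<Rightarrow> nat \<Rightarrow> nat set \<Rightarrow> nat \<Rightarrow> nat list" where
  "diag_index d n R i = map (\<lambda>k. if k \<in> R then n + 1 - i else i) [0..<d]"

definition magic_hypercube ::
    "nat \<Rightarrow> nat \<Rightarrow> 'a::linordered_semidom \<Rightarrow> (nat list \<Rightarrow> 'a) \<Rightarrow> bool" where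
  "magic_hypercube d n s x \<longleftrightarrow>
     semi_magic_hypercube d n s x \<and>
     (\<forall>R\<subseteq>{..<d}. (\<Sum>i=1..n. x (diag_index d n R i)) = s)"

text \<open>
  Requiring \<open>x\<close> to be \<^const>\<open>extensional\<close> makes arrays correspond bijectively to functions, so that
  \<^const>\<open>card\<close> counts arrays; for \<open>n \<ge> 1\<close> the set is finite, all entries being bounded by \<open>s\<close>.
\<close>

definition MC :: "nat \<Rightarrow> nat \<Rightarrow> nat" where
  "MC n s = card {x :: nat list \<Rightarrow> nat. x \<in> extensional (hc_index 3 n) \<and> magic_hypercube 3 n s x}"

definition quasipolynomial_with ::
    "(nat \<Rightarrow> complex) \<Rightarrow> nat \<Rightarrow> (nat \<Rightarrow> complex poly) \<Rightarrow> bool" where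
  "quasipolynomial_with f N p \<longleftrightarrow>
     N > 0 \<and> (\<forall>i<N. \<forall>m. m mod N = i \<longrightarrow> f m = poly (p i) (of_nat m))"

text \<open>
  The degree does not depend on the chosen representation: each constituent is determined by its
  values on an infinite residue class.
\<close>

definition quasipolynomial_of_degree :: "(nat \<Rightarrow> complex) \<Rightarrow> nat \<Rightarrow> bool" where
  "quasipolynomial_of_degree f D \<longleftrightarrow>
     (\<exists>N p. quasipolynomial_with f N p \<and> D = (MAX i\<in>{..<N}. degree (p i)))"

text \<open>
  The index type \<open>3\<close> has the elements 0, 1, 2 with arithmetic modulo 3; \<^const>\<open>of_nat\<close> maps
  \<open>{1..3}\<close> bijectively onto it (3 is sent to 0).
\<close>

definition hc_entries :: "real^3^3^3^3 \<Rightarrow> nat list \<Rightarrow> real" where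
  "hc_entries x v = vec_nth (vec_nth (vec_nth (vec_nth x
     (of_nat (v ! 0))) (of_nat (v ! 1))) (of_nat (v ! 2))) (of_nat (v ! 3))"

definition stochastic_magic_hypercubes_3333 :: "(real^3^3^3^3) set" where
  "stochastic_magic_hypercubes_3333 = {x. magic_hypercube 4 3 1 (hc_entries x)}"

definition integral_polytope :: "'a::euclidean_space set \<Rightarrow> bool" where
  "integral_polytope P \<longleftrightarrow> (\<forall>v. v extreme_point_of P \<longrightarrow> (\<forall>b\<in>Basis. v \<bullet> b \<in> \<int>))"

end

theory Submission
  imports Defs
begin

text \<open>
  Quasipolynomiality. Magic hypercubes are the nonnegative integer solutions of a homogeneous linear
  system, counted by their total. Splitting the solutions by whether \<open>c u \<ge> c v\<close> and substituting
  (Elliott's reduction) removes one equation after the other. Removing from each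
  piece the facets visible from a fixed interior vector \<open>q\<close> of the cone keeps the pieces disjoint, and
  each unconstrained piece has a proper rational generating function
  \<open>X ^ e / (\<Prod>i. 1 - X ^ d i)\<close>, \<open>e < (\<Sum>i. d i)\<close>. The count is therefore a quasipolynomial for all
  \<open>s \<ge> 0\<close>, not only for large \<open>s\<close>.

  Degree. The differences of two magic cubes of equal magic sum have \<open>(n - 1) ^ 3 - 4\<close> free entries
  (for \<open>n = 4\<close> one diagonal condition is redundant); these entries bound the count from above,
  and adding small combinations of a dual basis to a constant cube bounds it from below.

  Side 3. Summing lines and diagonals gives the centre \<open>s / 3\<close>. What remains is a lattice point count in
  four corner entries. In dimension 4 the same argument gives the centre \<open>s / 3\<close>, so that no stochastic
  magic hypercube of side 3 is integral.
\<close>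

section \<open>Quasipolynomials and generating functions\<close>

text \<open>The obstacle is the value at s = 0. A piece whose equations admit only the zero array
  counts 1 at s = 0 and 0 afterwards, which is no quasipolynomial; an arbitrary rule for ties c u =
  c v can produce such pieces, or improper generating functions. The vector q excludes both. It
  solves the equations and has no zero entry, so a nonzero row with coefficients of one sign makes q
  negative at some position where all solutions vanish; the facet there is removed and the piece is
  empty. Its weighted total is positive, so some facet is kept, whence e < (\<Sum>i. d i). Both
  properties survive because q is transformed like a solution. The start is the all-ones array, for
  which no facet is removed.

  For the degree, the array that adjusts one diagonal must leave the other diagonals alone. From
  side 5 on there is room for this; side 4 has room for three diagonals only, and side 3 for none,
  so there the degree is read from the explicit formula.\<close>

definition quasipolynomial :: "(nat \<Rightarrow> complex) \<Rightarrow> bool" where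
  "quasipolynomial f \<longleftrightarrow> (\<exists>N p. quasipolynomial_with f N p)"

lemma quasipolynomialI:
  assumes "N > 0" "\<And>m. f m = poly (p (m mod N)) (of_nat m)"
  shows "quasipolynomial f"
  using assms unfolding quasipolynomial_def quasipolynomial_with_def by blast

lemma quasipolynomialE:
  assumes "quasipolynomial f"
  obtains N p where "N > 0" "\<And>m. f m = poly (p (m mod N)) (of_nat m)"
  using assms unfolding quasipolynomial_def quasipolynomial_with_def
  by (metis mod_less_divisor)

lemma quasipolynomial_zero: "quasipolynomial (\<lambda>_. 0)"
  by (rule quasipolynomialI[of 1 _ "\<lambda>_. 0"]) auto

lemma quasipolynomial_add:
  assumes "quasipolynomial f" "quasipolynomial g"
  shows "quasipolynomial (\<lambda>m. f m + g m)"
proof -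
  obtain N p where N: "N > 0" "\<And>m. f m = poly (p (m mod N)) (of_nat m)"
    using quasipolynomialE[OF assms(1)] by metis
  obtain M r where M: "M > 0" "\<And>m. g m = poly (r (m mod M)) (of_nat m)"
    using quasipolynomialE[OF assms(2)] by metis
  show ?thesis
    using N M
    by (intro quasipolynomialI[of "N * M" _ "\<lambda>i. p (i mod N) + r (i mod M)"])
       (auto simp: mod_mult2_eq' mod_mod_cancel)
qed

lemma quasipolynomial_scale_argument:
  assumes "quasipolynomial f"
  shows "quasipolynomial (\<lambda>m. f (k * m))"
proof -
  obtain N p where N: "N > 0" "\<And>m. f m = poly (p (m mod N)) (of_nat m)"
    using quasipolynomialE[OF assms(1)] by metis
  show ?thesis
    using N
    by (intro quasipolynomialI[of N _ "\<lambda>i. pcompose (p (k * i mod N)) [:0, of_nat k:]"])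
       (auto simp: poly_pcompose mod_mult_right_eq mult.commute)
qed

section \<open>Power series with denominator (1 - X^N)^(k+1)\<close>

lemma binomial_eq_prod:
  "of_nat ((t + k) choose k) = (\<Prod>l=1..k. (of_nat t + of_nat l) / of_nat l :: complex)"
proof (induction k)
  case (Suc k)
  have "(Suc k) * ((t + Suc k) choose Suc k) = (t + Suc k) * ((t + k) choose k)"
    using Suc_times_binomial_eq[of "t + k" k] by simp
  then have "of_nat (Suc k) * of_nat ((t + Suc k) choose Suc k)
      = (of_nat (t + Suc k) * of_nat ((t + k) choose k) :: complex)"
    by (metis of_nat_mult)
  then have "of_nat ((t + Suc k) choose Suc k)
      = (of_nat ((t + k) choose k) :: complex) * (of_nat (t + Suc k) / of_nat (Suc k))"
    by (simp add: field_simps del: binomial_Suc_Suc of_nat_Suc)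
  also have "\<dots> = (\<Prod>l=1..Suc k. (of_nat t + of_nat l) / of_nat l)"
    unfolding Suc.IH by simp
  finally show ?case .
qed simp

text \<open>The series of 1 / (1 - X^N)^(k+1); \<open>binomial_fps_mult\<close> states this as a
  product, without division of power series.\<close>

definition binomial_fps :: "nat \<Rightarrow> nat \<Rightarrow> complex fps" where
  "binomial_fps N k = Abs_fps (\<lambda>t. if N dvd t then of_nat ((t div N + k) choose k) else 0)"

lemma binomial_fps_mult:
  assumes "N > 0"
  shows "binomial_fps N k * (1 - fps_X ^ N) ^ Suc k = 1"
proof (induction k)
  case 0
  show ?case
    using assms
    by (auto simp: fps_eq_iff binomial_fps_def right_diff_distrib fps_X_power_mult_right_nth
          dvd_minus_self not_less)
next
  case (Suc k)
  have "binomial_fps N (Suc k) * (1 - fps_X ^ N) = binomial_fps N k"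
  proof (rule fps_ext)
    fix t
    show "fps_nth (binomial_fps N (Suc k) * (1 - fps_X ^ N)) t = fps_nth (binomial_fps N k) t"
    proof (cases "N dvd t")
      case True
      then obtain l where l: "t = N * l" by auto
      show ?thesis
      proof (cases l)
        case 0
        then show ?thesis using assms l
          by (simp add: binomial_fps_def right_diff_distrib fps_X_power_mult_right_nth)
      next
        case (Suc l')
        have "N * Suc l' - N = N * l'" by simp
        then show ?thesis using assms l Suc
          by (simp add: binomial_fps_def right_diff_distrib fps_X_power_mult_right_nth del: mult_Suc_right)
      qed
    next
      case False
      then show ?thesis using assms
        by (auto simp: binomial_fps_def right_diff_distrib fps_X_power_mult_right_nth dvd_minus_self)
    qed
  qed
  then have "binomial_fps N (Suc k) * (1 - fps_X ^ N) ^ Suc (Suc k)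
      = binomial_fps N k * (1 - fps_X ^ N) ^ Suc k"
    by (simp only: power_Suc[of _ "Suc k"] mult.assoc[symmetric])
  then show ?case using Suc.IH by (simp only:)
qed

text \<open>For j congruent to s modulo N, the coefficient attached to exponent j is a polynomial in
  s that vanishes for (s - j) / N in {-k..-1}. All exponents of the numerator are below N * (k + 1),
  so these zeros cover every term with j > s, and the formula holds from s = 0 on.\<close>

lemma quasipolynomial_binomial_convolution:
  assumes N: "N > 0" and deg: "\<And>j. j \<ge> N * Suc k \<Longrightarrow> P j = 0"
  shows "quasipolynomial (fps_nth (Abs_fps P * binomial_fps N k))"
proof -
  define G where
    "G j = (\<Prod>l=1..k. [:(of_nat l - of_nat j / of_nat N) / of_nat l, 1 / (of_nat N * of_nat l) :: complex:])"
    for j :: nat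
  define p where "p i = (\<Sum>j | j < N * Suc k \<and> j mod N = i. smult (P j) (G j))" for i
  have poly_G: "poly (G j) (of_nat s) = (\<Prod>l=1..k. (of_nat l + (of_nat s - of_nat j) / of_nat N) / of_nat l)"
    for j s
    unfolding G_def poly_prod
    by (intro prod.cong) (use N in \<open>auto simp: field_simps\<close>)
  have val: "fps_nth (binomial_fps N k) (s - j) * (if j \<le> s then 1 else 0)
      = (if j mod N = s mod N then poly (G j) (of_nat s) else 0)"
    if j: "j < N * Suc k" for j s
  proof (cases "j mod N = s mod N")
    case True
    show ?thesis
    proof (cases "j \<le> s")
      case le: True
      then have "N dvd s - j" using True by (metis mod_eq_dvd_iff_nat)
      then obtain t where t: "s - j = N * t" by auto
      then have s: "s = j + N * t" using le by linarith
      have "poly (G j) (of_nat s) = (\<Prod>l=1..k. (of_nat t + of_nat l) / of_nat l)"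
        unfolding poly_G by (intro prod.cong) (use N in \<open>auto simp: s\<close>)
      then show ?thesis using True le N
        by (simp add: binomial_fps_def t binomial_eq_prod)
    next
      case False
      then have "N dvd j - s" using True by (metis mod_eq_dvd_iff_nat nat_le_linear)
      then obtain l where l: "j - s = N * l" by auto
      then have jl: "j = s + N * l" using False by linarith
      have "l \<ge> 1" using False jl by (cases l) auto
      moreover have "l < Suc k" using j jl N by (metis add_leD2 le_less_trans mult_less_cancel1 le_refl)
      ultimately have "poly (G j) (of_nat s) = 0"
        unfolding poly_G by (subst prod_zero_iff) (use N jl in \<open>auto intro!: bexI[of _ l]\<close>)
      then show ?thesis using True False by simp
    qed
  next
    case False
    then have "\<not> N dvd s - j" if "j \<le> s" using that by (metis mod_eq_dvd_iff_nat)
    then show ?thesis using False by (simp add: binomial_fps_def)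
  qed
  have "fps_nth (Abs_fps P * binomial_fps N k) s = poly (p (s mod N)) (of_nat s)" for s
  proof -
    have "fps_nth (Abs_fps P * binomial_fps N k) s
        = (\<Sum>j\<in>{0..s}. P j * fps_nth (binomial_fps N k) (s - j))"
      by (simp add: fps_mult_nth)
    \<comment> \<open>The enlarged index set leads to one independent of s: terms beyond s carry the
      factor 0, and P vanishes beyond the degree bound.\<close>
    also have "\<dots> = (\<Sum>j\<in>{0..s} \<union> {..<N * Suc k}.
        P j * (fps_nth (binomial_fps N k) (s - j) * (if j \<le> s then 1 else 0)))"
      by (intro sum.mono_neutral_cong_left) auto
    also have "\<dots> = (\<Sum>j\<in>{..<N * Suc k}.
        P j * (fps_nth (binomial_fps N k) (s - j) * (if j \<le> s then 1 else 0)))"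
      by (intro sum.mono_neutral_right) (auto simp: deg not_less)
    also have "\<dots> = (\<Sum>j\<in>{..<N * Suc k}. if j mod N = s mod N then P j * poly (G j) (of_nat s) else 0)"
      by (intro sum.cong refl) (subst val, auto)
    also have "\<dots> = poly (p (s mod N)) (of_nat s)"
      unfolding p_def poly_sum by (simp add: sum.inter_filter[symmetric] conj_commute)
    finally show ?thesis .
  qed
  then show ?thesis using N by (intro quasipolynomialI)
qed

text \<open>With N the product of all d i, the geometric sums \<open>G i\<close> complete each
  factor to 1 - X^N. Their degrees N - d i turn the hypothesis on e into a numerator degree below N
  * card I, the degree of the common denominator.\<close>

lemma quasipolynomial_fps_nth:
  assumes I: "finite I" and d: "\<And>i. i \<in> I \<Longrightarrow> d i > 0" and e: "e < (\<Sum>i\<in>I. d i)"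
    and F: "F * (\<Prod>i\<in>I. 1 - fps_X ^ d i) = fps_X ^ e"
  shows "quasipolynomial (fps_nth (F :: complex fps))"
proof -
  define N where "N = (\<Prod>i\<in>I. d i)"
  have N: "N > 0" using d by (auto simp: N_def intro: prod_pos)
  have "I \<noteq> {}" using e by auto
  then obtain k where k: "card I = Suc k" using I by (metis card_gt_0_iff gr0_implies_Suc)
  define G where "G i = (\<Sum>l<N div d i. monom (1::complex) (d i * l))" for i
  have dN: "d i dvd N" if "i \<in> I" for i using that I by (auto simp: N_def)
  have G: "fps_of_poly (G i) * (1 - fps_X ^ d i) = 1 - fps_X ^ N" if "i \<in> I" for i
  proof -
    have "fps_of_poly (G i) = (\<Sum>l<N div d i. (fps_X ^ d i) ^ l)"
      by (simp add: G_def fps_of_poly_sum fps_of_poly_monom power_mult)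
    then have "fps_of_poly (G i) * (1 - fps_X ^ d i) = 1 - (fps_X ^ d i) ^ (N div d i)"
      by (metis one_diff_power_eq mult.commute)
    then show ?thesis using dN[OF that] by (simp flip: power_mult)
  qed
  have degG: "degree (G i) \<le> N - d i" if "i \<in> I" for i
  proof -
    obtain l where l: "N = d i * l" using dN[OF \<open>i \<in> I\<close>] by (rule dvdE)
    have "degree (monom (1::complex) (d i * m)) \<le> N - d i" if "m < N div d i" for m
    proof -
      have "Suc m \<le> l" using that d[OF \<open>i \<in> I\<close>] l by simp
      then have "d i * Suc m \<le> N" unfolding l by (rule mult_le_mono2)
      then show ?thesis by (simp add: degree_monom_eq)
    qed
    then show ?thesis unfolding G_def by (intro degree_sum_le) auto
  qed
  define p where "p = monom 1 e * (\<Prod>i\<in>I. G i)"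
  have "degree p \<le> e + (\<Sum>i\<in>I. N - d i)"
    unfolding p_def
    by (rule order.trans[OF degree_mult_le])
       (intro add_mono degree_monom_le order.trans[OF degree_prod_sum_le[OF I]] sum_mono, auto simp: degG)
  also have "\<dots> < (\<Sum>i\<in>I. d i) + (\<Sum>i\<in>I. N - d i)" using e by simp
  also have "\<dots> = (\<Sum>i\<in>I. N)"
    unfolding sum.distrib[symmetric] using dN d N by (intro sum.cong refl) (simp add: dvd_imp_le)
  also have "\<dots> = N * Suc k" using k by simp
  finally have degp: "degree p < N * Suc k" .
  have "F * (1 - fps_X ^ N) ^ Suc k = F * (\<Prod>i\<in>I. fps_of_poly (G i) * (1 - fps_X ^ d i))"
    unfolding k[symmetric] prod_constant[symmetric] by (intro arg_cong2[where f = "(*)"] prod.cong) (simp_all only: G)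
  also have "\<dots> = (F * (\<Prod>i\<in>I. 1 - fps_X ^ d i)) * (\<Prod>i\<in>I. fps_of_poly (G i))"
    by (simp add: prod.distrib mult_ac)
  also have "\<dots> = fps_of_poly p"
    by (simp add: F p_def fps_of_poly_mult fps_of_poly_monom fps_of_poly_prod)
  finally have "fps_of_poly p * binomial_fps N k
      = F * (binomial_fps N k * (1 - fps_X ^ N) ^ Suc k)"
    by (simp add: mult_ac)
  then have "F = Abs_fps (coeff p) * binomial_fps N k"
    using N by (simp only: binomial_fps_mult) (simp add: fps_of_poly_def)
  then show ?thesis
    using quasipolynomial_binomial_convolution[OF N, of k "coeff p"] degp
    by (simp add: coeff_eq_0)
qed

section \<open>Solutions of homogeneous linear Diophantine systems\<close>

text \<open>Only the signs of \<open>q\<close> enter here: a negative \<open>q i\<close> removes the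
  facet c i = 0. Its values matter in \<open>admissible\<close>.\<close>

definition solutions ::
    "'i set \<Rightarrow> 'j set \<Rightarrow> ('i \<Rightarrow> 'j \<Rightarrow> int) \<Rightarrow> ('i \<Rightarrow> nat) \<Rightarrow> ('i \<Rightarrow> int) \<Rightarrow> nat \<Rightarrow> ('i \<Rightarrow> nat) set" where
  "solutions I J a d q s = {c \<in> extensional I. (\<forall>i\<in>I. q i < 0 \<longrightarrow> c i > 0) \<and>
     (\<forall>j\<in>J. (\<Sum>i\<in>I. int (c i) * a i j) = 0) \<and> (\<Sum>i\<in>I. c i * d i) = s}"

lemma finite_solutions:
  assumes I: "finite I" and d: "\<And>i. i \<in> I \<Longrightarrow> d i > 0"
  shows "finite (solutions I J a d q s)"
proof (rule finite_subset)
  show "solutions I J a d q s \<subseteq> (\<Pi>\<^sub>E i\<in>I. {..s})"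
  proof
    fix c assume c: "c \<in> solutions I J a d q s"
    have "c i \<le> s" if i: "i \<in> I" for i
    proof -
      have "c i \<le> c i * d i" using d[OF i] by simp
      also have "\<dots> \<le> (\<Sum>i\<in>I. c i * d i)" using i I by (intro member_le_sum) auto
      also have "\<dots> = s" using c by (simp add: solutions_def)
      finally show ?thesis .
    qed
    then show "c \<in> (\<Pi>\<^sub>E i\<in>I. {..s})" using c by (auto simp: solutions_def PiE_def)
  qed
qed (use I in \<open>auto intro: finite_PiE\<close>)

lemma bij_betw_solutions_increment:
  assumes I: "finite I" and i: "i \<in> I"
  shows "bij_betw (\<lambda>c. c(i := Suc (c i))) (solutions I {} a d q s)
           {c \<in> solutions I {} a d q (s + d i). c i > (if q i < 0 then 1 else 0)}"
proof (rule bij_betw_byWitness[where f' = "\<lambda>c. c(i := c i - 1)"])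
  have sum: "(\<Sum>l\<in>I. (c(i := x)) l * d l) = x * d i + (\<Sum>l\<in>I - {i}. c l * d l)" for c x
    using I i by (subst sum.remove[of I i]) (auto intro!: sum.cong)
  have sum': "(\<Sum>l\<in>I. c l * d l) = c i * d i + (\<Sum>l\<in>I - {i}. c l * d l)" for c
    using I i by (rule sum.remove)
  show "(\<lambda>c. c(i := Suc (c i))) ` solutions I {} a d q s
      \<subseteq> {c \<in> solutions I {} a d q (s + d i). c i > (if q i < 0 then 1 else 0)}"
  proof clarify
    fix c assume c: "c \<in> solutions I {} a d q s"
    have "(\<Sum>l\<in>I. (c(i := Suc (c i))) l * d l) = (\<Sum>l\<in>I. c l * d l) + d i"
      unfolding sum sum'[of c] by simp
    then show "c(i := Suc (c i)) \<in> solutions I {} a d q (s + d i)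
        \<and> (c(i := Suc (c i))) i > (if q i < 0 then 1 else 0)"
      using c i by (auto simp: solutions_def extensional_def)
  qed
  show "(\<lambda>c. c(i := c i - 1)) ` {c \<in> solutions I {} a d q (s + d i). c i > (if q i < 0 then 1 else 0)}
      \<subseteq> solutions I {} a d q s"
  proof
    fix c' assume "c' \<in> (\<lambda>c. c(i := c i - 1)) ` {c \<in> solutions I {} a d q (s + d i). c i > (if q i < 0 then 1 else 0)}"
    then obtain c where c: "c \<in> solutions I {} a d q  (s + d i)" "c i > (if q i < 0 then 1 else 0)" "c' = c(i := c i - 1)"
      by auto
    obtain y where y: "c i = Suc y" using c(2) by (cases "c i") (auto split: if_splits)
    have "(\<Sum>l\<in>I. c' l * d l) + d i = (\<Sum>l\<in>I. c l * d l)"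
      unfolding c(3) sum sum'[of c] by (simp add: y)
    then show "c' \<in> solutions I {} a d q s"
      using c i by (auto simp: solutions_def extensional_def)
  qed
qed auto

lemma card_solutions_insert:
  assumes I: "finite I" and i: "i \<notin> I"
  shows "card {c \<in> solutions (insert i I) {} a d q s. c i = x}
       = (if x * d i \<le> s \<and> (q i < 0 \<longrightarrow> x > 0) then card (solutions I {} a d q (s - x * d i)) else 0)"
proof -
  have sum: "(\<Sum>l\<in>insert i I. (c(i := y)) l * d l) = y * d i + (\<Sum>l\<in>I. c l * d l)" for c y
    using I i by (subst sum.insert) (auto intro!: sum.cong)
  have sum': "(\<Sum>l\<in>insert i I. c l * d l) = c i * d i + (\<Sum>l\<in>I. c l * d l)" for c
    using I i by (rule sum.insert)
  show ?thesis
  proof (cases "x * d i \<le> s \<and> (q i < 0 \<longrightarrow> x > 0)")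
    case True
    have "bij_betw (\<lambda>c. c(i := x)) (solutions I {} a d q (s - x * d i))
        {c \<in> solutions (insert i I) {} a d q s. c i = x}"
    proof (rule bij_betw_byWitness[where f' = "\<lambda>c. c(i := undefined)"])
      show "(\<lambda>c. c(i := x)) ` solutions I {} a d q (s - x * d i)
          \<subseteq> {c \<in> solutions (insert i I) {} a d q s. c i = x}"
      proof clarify
        fix c assume "c \<in> solutions I {} a d q (s - x * d i)"
        then show "c(i := x) \<in> solutions (insert i I) {} a d q s \<and> (c(i := x)) i = x"
          using True i unfolding solutions_def mem_Collect_eq sum
          by (auto simp: extensional_def)
      qed
      show "(\<lambda>c. c(i := undefined)) ` {c \<in> solutions (insert i I) {} a d q s. c i = x}
          \<subseteq> solutions I {} a d q (s - x * d i)"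
      proof clarify
        fix c assume c: "c \<in> solutions (insert i I) {} a d q s" "x = c i"
        have "(\<Sum>l\<in>I. (c(i := undefined)) l * d l) = (\<Sum>l\<in>I. c l * d l)"
          using i by (intro sum.cong) auto
        then show "c(i := undefined) \<in> solutions I {} a d q (s - c i * d i)"
          using c i unfolding solutions_def mem_Collect_eq sum'
          by (auto simp: extensional_def)
      qed
      show "\<forall>c\<in>solutions I {} a d q (s - x * d i). c(i := x, i := undefined) = c"
        using i by (auto simp: solutions_def extensional_def fun_eq_iff)
    qed auto
    then show ?thesis using True by (simp add: bij_betw_same_card)
  next
    case False
    have "{c \<in> solutions (insert i I) {} a d q s. c i = x} = {}"
      using False unfolding solutions_def sum' by auto
    then show ?thesis unfolding if_not_P[OF False] by (simp only: card.empty)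
  qed
qed

lemma fps_solutions_unconstrained:
  assumes "finite I" and "\<And>i. i \<in> I \<Longrightarrow> d i > 0"
  shows "Abs_fps (\<lambda>s. of_nat (card (solutions I {} a d q s)) :: complex)
           * (\<Prod>i\<in>I. 1 - fps_X ^ d i) = fps_X ^ (\<Sum>i\<in>I. if q i < 0 then d i else 0)"
  using assms
proof (induction I)
  case empty
  have "card (solutions {} {} a d q s) = (if s = 0 then 1 else 0)" for s
    by (auto simp: solutions_def)
  then show ?case by (auto simp: fps_eq_iff)
next
  case (insert i I)
  define f where "f I s = (of_nat (card (solutions I {} a d q s)) :: complex)" for I s
  define e where "e = (if q i < 0 then d i else 0)"
  define x where "x = (if q i < 0 then 1 else 0 :: nat)"
  have d: "d i > 0" "\<And>l. l \<in> insert i I \<Longrightarrow> d l > 0" using insert.prems by auto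
  have fin: "finite (solutions (insert i I) {} a d q s)" for s
    using insert.hyps d by (intro finite_solutions) auto
  have "card (solutions (insert i I) {} a d q s)
      = (if e \<le> s then card (solutions I {} a d q (s - e)) else 0)
        + (if d i \<le> s then card (solutions (insert i I) {} a d q (s - d i)) else 0)" for s
  proof -
    have "card (solutions (insert i I) {} a d q s)
        = card {c \<in> solutions (insert i I) {} a d q s. c i = x}
          + card {c \<in> solutions (insert i I) {} a d q s. c i > x}"
    proof (subst card_Un_disjoint[symmetric])
      show "card (solutions (insert i I) {} a d q s)
          = card ({c \<in> solutions (insert i I) {} a d q s. c i = x}
                  \<union> {c \<in> solutions (insert i I) {} a d q s. c i > x})"
        by (intro arg_cong[where f = card]) (auto simp: x_def solutions_def)
    qed (use fin[of s] in auto)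
    also have "card {c \<in> solutions (insert i I) {} a d q s. c i = x}
        = (if e \<le> s then card (solutions I {} a d q (s - e)) else 0)"
      using insert.hyps by (subst card_solutions_insert) (auto simp: x_def e_def)
    also have "card {c \<in> solutions (insert i I) {} a d q s. c i > x}
        = (if d i \<le> s then card (solutions (insert i I) {} a d q (s - d i)) else 0)"
    proof (cases "d i \<le> s")
      case True
      have "bij_betw (\<lambda>c. c(i := Suc (c i))) (solutions (insert i I) {} a d q (s - d i))
              {c \<in> solutions (insert i I) {} a d q s. c i > x}"
        using bij_betw_solutions_increment[where I = "insert i I" and i = i and q = q and d = d
            and a = a and s = "s - d i"] insert.hyps True
        by (auto simp: x_def)
      then show ?thesis using True by (simp add: bij_betw_same_card)
    next
      case False
      have "{c \<in> solutions (insert i I) {} a d q s. c i > x} = {}"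
      proof (rule ccontr)
        assume "\<not> ?thesis"
        then obtain c where c: "c \<in> solutions (insert i I) {} a d q s" "c i > x" by auto
        have "d i \<le> c i * d i" using c(2) by simp
        also have "\<dots> \<le> s" using c(1) insert.hyps by (simp add: solutions_def)
        finally show False using False by simp
      qed
      then show ?thesis using False by (simp only: card.empty if_False)
    qed
    finally show ?thesis .
  qed
  then have f: "f (insert i I) s = (if e \<le> s then f I (s - e) else 0)
      + (if d i \<le> s then f (insert i I) (s - d i) else 0)" for s
    by (simp add: f_def)
  have "Abs_fps (f (insert i I)) * (1 - fps_X ^ d i) = Abs_fps (f I) * fps_X ^ e"
  proof (rule fps_ext)
    fix s
    show "fps_nth (Abs_fps (f (insert i I)) * (1 - fps_X ^ d i)) s = fps_nth (Abs_fps (f I) * fps_X ^ e) s"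
      using f[of s] by (auto simp: right_diff_distrib fps_X_power_mult_right_nth split: if_splits)
  qed
  then have "Abs_fps (f (insert i I)) * (\<Prod>i\<in>insert i I. 1 - fps_X ^ d i)
      = (Abs_fps (f I) * (\<Prod>i\<in>I. 1 - fps_X ^ d i)) * fps_X ^ e"
    using insert.hyps by (simp add: mult.assoc[symmetric])
  also have "\<dots> = fps_X ^ (\<Sum>i\<in>insert i I. if q i < 0 then d i else 0)"
    unfolding f_def using insert by (simp add: e_def power_add mult_ac)
  finally show ?case by (simp only: f_def[symmetric])
qed

lemma quasipolynomial_solutions_unconstrained:
  assumes I: "finite I" and d: "\<And>i. i \<in> I \<Longrightarrow> d i > 0" and i: "i \<in> I" "\<not> q i < 0"
  shows "quasipolynomial (\<lambda>s. of_nat (card (solutions I {} a d q s)))"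
proof -
  have "(\<Sum>i\<in>I. if q i < 0 then d i else 0) < (\<Sum>i\<in>I. d i)"
    using I d i by (intro sum_strict_mono_ex1) (auto intro!: bexI[of _ i])
  then have "quasipolynomial (fps_nth (Abs_fps (\<lambda>s. of_nat (card (solutions I {} a d q s)))))"
    using fps_solutions_unconstrained[of I d a q] I d by (intro quasipolynomial_fps_nth[OF I]) auto
  then show ?thesis by (simp add: Abs_fps_inverse)
qed

section \<open>Elliott's reduction\<close>

lemma sum_remove2:
  assumes "finite I" "u \<in> I" "v \<in> I" "u \<noteq> v"
  shows "(\<Sum>i\<in>I. f i) = f u + (f v + (\<Sum>i\<in>I - {u} - {v}. f i))"
  using assms by (simp add: sum.remove[of I u] sum.remove[of "I - {u}" v] del: Diff_insert)

text \<open>Substitute c u = c' u + c v: column u is added to column v, and the condition becomes c'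
  u \<ge> 0, strict exactly if z < 0. Ties belong to the piece on which the difference of
  \<open>q\<close> is positive.\<close>

lemma card_solutions_ge:
  fixes q :: "'i \<Rightarrow> int"
  assumes I: "finite I" and uv: "u \<in> I" "v \<in> I" "u \<noteq> v"
    and z: "z < 0 \<longleftrightarrow> q u < q v" and q: "q u \<noteq> q v"
  shows "card {c \<in> solutions I J a d q s. c u \<ge> c v + (if q u < q v then 1 else 0)}
    = card (solutions I J (a(v := \<lambda>j. a u j + a v j)) (d(v := d u + d v)) (q(u := z)) s)"
    (is "card ?A = card ?B")
proof -
  let ?a = "a(v := \<lambda>j. a u j + a v j)" and ?d = "d(v := d u + d v)" and ?q = "q(u := z)"
  let ?f = "\<lambda>c. c(u := c u - c v :: nat)" and ?g = "\<lambda>c. c(u := c u + c v :: nat)"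
  have rest: "(\<Sum>i\<in>I - {u} - {v}. int ((c(u := x)) i) * ?a i j) = (\<Sum>i\<in>I - {u} - {v}. int (c i) * a i j)"
    for c x j by (intro sum.cong) auto
  have rest': "(\<Sum>i\<in>I - {u} - {v}. (c(u := x)) i * ?d i) = (\<Sum>i\<in>I - {u} - {v}. c i * d i)"
    for c x by (intro sum.cong) auto
  have sum: "(\<Sum>i\<in>I. int (?f c i) * ?a i j) = (\<Sum>i\<in>I. int (c i) * a i j)" if "c u \<ge> c v" for c j
  proof -
    have "(\<Sum>i\<in>I. int (?f c i) * ?a i j) = (int (c u) - int (c v)) * a u j
        + (int (c v) * (a u j + a v j) + (\<Sum>i\<in>I - {u} - {v}. int (c i) * a i j))"
      unfolding sum_remove2[OF I uv, of "\<lambda>i. int (?f c i) * ?a i j"] rest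
      using uv that by (simp add: of_nat_diff)
    also have "\<dots> = (\<Sum>i\<in>I. int (c i) * a i j)"
      unfolding sum_remove2[OF I uv, of "\<lambda>i. int (c i) * a i j"] by (simp add: algebra_simps)
    finally show ?thesis .
  qed
  have sum': "(\<Sum>i\<in>I. ?f c i * ?d i) = (\<Sum>i\<in>I. c i * d i)" if "c u \<ge> c v" for c
  proof -
    obtain x where x: "c u = c v + x" using \<open>c u \<ge> c v\<close> by (metis le_Suc_ex)
    have "(\<Sum>i\<in>I. ?f c i * ?d i) = x * d u + (c v * (d u + d v) + (\<Sum>i\<in>I - {u} - {v}. c i * d i))"
      unfolding sum_remove2[OF I uv, of "\<lambda>i. ?f c i * ?d i"] rest' using uv x by simp
    also have "\<dots> = (\<Sum>i\<in>I. c i * d i)"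
      unfolding sum_remove2[OF I uv, of "\<lambda>i. c i * d i"] x by (simp add: algebra_simps)
    finally show ?thesis .
  qed
  have "bij_betw ?f ?A ?B"
  proof (rule bij_betw_byWitness[where f' = ?g])
    show "\<forall>c\<in>?A. ?g (?f c) = c" "\<forall>c\<in>?B. ?f (?g c) = c" using uv by (auto simp: fun_eq_iff)
    show "?f ` ?A \<subseteq> ?B"
    proof clarify
      fix c assume c: "c \<in> solutions I J a d q s" "c u \<ge> c v + (if q u < q v then 1 else 0)"
      then have le: "c u \<ge> c v" by auto
      show "?f c \<in> ?B"
        using c uv z unfolding solutions_def mem_Collect_eq sum[OF le] sum'[OF le]
        by (auto simp: extensional_def split: if_splits)
    qed
    show "?g ` ?B \<subseteq> ?A"
    proof clarify
      fix c assume c: "c \<in> ?B"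
      have fg: "?f (?g c) = c" using uv by (auto simp: fun_eq_iff)
      have le: "?g c u \<ge> ?g c v" using uv by auto
      have S: "(\<Sum>i\<in>I. int (?g c i) * a i j) = (\<Sum>i\<in>I. int (c i) * ?a i j)" for j
        using sum[OF le, of j] unfolding fg by simp
      have S': "(\<Sum>i\<in>I. ?g c i * d i) = (\<Sum>i\<in>I. c i * ?d i)"
        using sum'[OF le] unfolding fg by simp
      \<comment> \<open>At i = u: if neither v nor the new u were marked, then q u > q v \<ge> 0,
        contrary to q u < 0. So one summand of c u + c v is positive.\<close>
      have pos: "0 < ?g c i" if i: "i \<in> I" "q i < 0" for i
      proof (cases "i = u")
        case True
        have "q v < 0 \<or> z < 0" using z q i by (cases "z < 0") (auto simp: True)
        then have "0 < c v \<or> 0 < c u" using c uv by (auto simp: solutions_def)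
        then show ?thesis using True by auto
      next
        case False
        then show ?thesis using c i by (auto simp: solutions_def)
      qed
      have "?g c \<in> solutions I J a d q s"
        using c uv pos unfolding solutions_def mem_Collect_eq S S' by (auto simp: extensional_def)
      moreover have "?g c u \<ge> ?g c v + (if q u < q v then 1 else 0)"
        using c uv z by (auto simp: solutions_def)
      ultimately show "?g c \<in> solutions I J a d q s \<and> ?g c u \<ge> ?g c v + (if q u < q v then 1 else 0)"
        by blast
    qed
  qed
  then show ?thesis by (rule bij_betw_same_card)
qed

text \<open>
  The sign pattern of \<open>q\<close> marks which facets of the cone are removed.  Updating \<open>q\<close> like a
  solution keeps it a consistent marking, so that the two half-open pieces do not overlap.
\<close>

lemma card_solutions_split:
  assumes I: "finite I" and d: "\<And>i. i \<in> I \<Longrightarrow> d i > 0"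
    and uv: "u \<in> I" "v \<in> I" "u \<noteq> v" "q u \<noteq> q v"
  shows "card (solutions I J a d q s)
    = card (solutions I J (a(v := \<lambda>j. a u j + a v j)) (d(v := d u + d v)) (q(u := q u - q v)) s)
    + card (solutions I J (a(u := \<lambda>j. a u j + a v j)) (d(u := d u + d v)) (q(v := q v - q u)) s)"
proof -
  have fin: "finite (solutions I J a d q s)" using I d by (rule finite_solutions)
  have "card (solutions I J a d q s)
      = card {c \<in> solutions I J a d q s. c u \<ge> c v + (if q u < q v then 1 else 0)}
      + card {c \<in> solutions I J a d q s. c v \<ge> c u + (if q v < q u then 1 else 0)}"
  proof (subst card_Un_disjoint[symmetric])
    show "card (solutions I J a d q s)
        = card ({c \<in> solutions I J a d q s. c u \<ge> c v + (if q u < q v then 1 else 0)}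
                \<union> {c \<in> solutions I J a d q s. c v \<ge> c u + (if q v < q u then 1 else 0)})"
      using uv by (intro arg_cong[where f = card]) auto
  qed (use fin uv in auto)
  also have "card {c \<in> solutions I J a d q s. c u \<ge> c v + (if q u < q v then 1 else 0)}
    = card (solutions I J (a(v := \<lambda>j. a u j + a v j)) (d(v := d u + d v)) (q(u := q u - q v)) s)"
    using uv by (intro card_solutions_ge I) auto
  also have "card {c \<in> solutions I J a d q s. c v \<ge> c u + (if q v < q u then 1 else 0)}
    = card (solutions I J (a(u := \<lambda>j. a v j + a u j)) (d(u := d v + d u)) (q(v := q v - q u)) s)"
    using uv by (intro card_solutions_ge I) auto
  finally show ?thesis by (simp only: add.commute)
qed

text \<open>The tie rule requires q u and q v to differ. If instead no solution separates u and v,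
  one variable can carry both columns and both weights; q u = q v makes their facet conditions
  agree.\<close>

lemma card_solutions_merge:
  assumes I: "finite I" and uv: "u \<in> I" "v \<in> I" "u \<noteq> v" "q u = q v"
    and eq: "\<And>s c. c \<in> solutions I J a d q s \<Longrightarrow> c u = c v"
  shows "card (solutions I J a d q s)
    = card (solutions (I - {v}) J (a(u := \<lambda>j. a u j + a v j)) (d(u := d u + d v)) q s)"
    (is "card ?A = card ?B")
proof -
  let ?a = "a(u := \<lambda>j. a u j + a v j)" and ?d = "d(u := d u + d v)"
  let ?f = "\<lambda>c. c(v := undefined)" and ?g = "\<lambda>c. c(v := c u)"
  have rem: "(\<Sum>i\<in>I - {v}. f i) = f u + (\<Sum>i\<in>I - {u} - {v}. f i)" for f :: "'a \<Rightarrow> 'c::comm_monoid_add"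
    using I uv by (simp add: sum.remove[of "I - {v}" u] Diff_insert2[symmetric] insert_commute)
  have rest: "(\<Sum>i\<in>I - {u} - {v}. int ((c(v := x)) i) * a i j) = (\<Sum>i\<in>I - {u} - {v}. int (c i) * ?a i j)"
    for c x j by (intro sum.cong) auto
  have rest': "(\<Sum>i\<in>I - {u} - {v}. (c(v := x)) i * d i) = (\<Sum>i\<in>I - {u} - {v}. c i * ?d i)"
    for c x by (intro sum.cong) auto
  have S: "(\<Sum>i\<in>I. int (?g c i) * a i j) = (\<Sum>i\<in>I - {v}. int (c i) * ?a i j)" for c j
    unfolding rem sum_remove2[OF I uv(1-3)] rest using uv by (simp add: algebra_simps)
  have S': "(\<Sum>i\<in>I. ?g c i * d i) = (\<Sum>i\<in>I - {v}. c i * ?d i)" for c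
    unfolding rem sum_remove2[OF I uv(1-3)] rest' using uv by (simp add: algebra_simps)
  have "bij_betw ?f ?A ?B"
  proof (rule bij_betw_byWitness[where f' = ?g])
    show gf: "\<forall>c\<in>?A. ?g (?f c) = c" using uv eq by (auto simp: fun_eq_iff)
    show "\<forall>c\<in>?B. ?f (?g c) = c" by (auto simp: fun_eq_iff solutions_def extensional_def)
    show "?g ` ?B \<subseteq> ?A"
    proof clarify
      fix c assume c: "c \<in> ?B"
      have "i = v \<or> i \<in> I - {v}" if "i \<in> I" for i using that by auto
      then show "?g c \<in> ?A"
        using c uv unfolding solutions_def mem_Collect_eq S S' by (auto simp: extensional_def)
    qed
    show "?f ` ?A \<subseteq> ?B"
    proof clarify
      fix c assume c: "c \<in> ?A"
      then have gf: "?g (?f c) = c" using gf by blast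
      have "(\<Sum>i\<in>I - {v}. int (?f c i) * ?a i j) = (\<Sum>i\<in>I. int (c i) * a i j)" for j
        using S[of "?f c" j] unfolding gf by simp
      moreover have "(\<Sum>i\<in>I - {v}. ?f c i * ?d i) = (\<Sum>i\<in>I. c i * d i)"
        using S'[of "?f c"] unfolding gf by simp
      ultimately show "?f c \<in> ?B"
        using c uv unfolding solutions_def mem_Collect_eq by (auto simp: extensional_def)
    qed
  qed
  then show ?thesis by (rule bij_betw_same_card)
qed

text \<open>What the transformed \<open>q\<close> retains of the interior vector: it lies in the
  solution space, on no coordinate hyperplane, and has positive weighted total. Its entries may be
  negative.\<close>

definition admissible ::
    "'i set \<Rightarrow> 'j set \<Rightarrow> ('i \<Rightarrow> 'j \<Rightarrow> int) \<Rightarrow> ('i \<Rightarrow> nat) \<Rightarrow> ('i \<Rightarrow> int) \<Rightarrow> bool" where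
  "admissible I J a d q \<longleftrightarrow> (\<forall>i\<in>I. d i > 0 \<and> q i \<noteq> 0) \<and>
     (\<forall>j\<in>J. (\<Sum>i\<in>I. q i * a i j) = 0) \<and> (\<Sum>i\<in>I. q i * int (d i)) > 0"

text \<open>All \<open>d\<close> and \<open>q\<close> are quantified because every split changes
  both, while the induction runs on the coefficients and the index sets.\<close>

definition quasipolynomial_counts :: "'i set \<Rightarrow> 'j set \<Rightarrow> ('i \<Rightarrow> 'j \<Rightarrow> int) \<Rightarrow> bool" where
  "quasipolynomial_counts I J a \<longleftrightarrow>
     (\<forall>d q. admissible I J a d q \<longrightarrow> quasipolynomial (\<lambda>s. of_nat (card (solutions I J a d q s))))"

text \<open>(q u - q v) * f u + q v * (f u + f v) = q u * f u + q v * f v, applied to every row and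
  to the weights. The new entry q u - q v is nonzero because q u and q v differ.\<close>

lemma admissible_split:
  fixes q :: "'i \<Rightarrow> int"
  assumes I: "finite I" and uv: "u \<in> I" "v \<in> I" "u \<noteq> v" "q u \<noteq> q v"
    and adm: "admissible I J a d q"
  shows "admissible I J (a(v := \<lambda>j. a u j + a v j)) (d(v := d u + d v)) (q(u := q u - q v))"
proof -
  have rest: "(\<Sum>i\<in>I - {u} - {v}. (q(u := x)) i * (f(v := y)) i) = (\<Sum>i\<in>I - {u} - {v}. q i * f i)"
    for x y and f :: "'i \<Rightarrow> int"
    by (intro sum.cong) auto
  have key: "(\<Sum>i\<in>I. (q(u := q u - q v)) i * (f(v := f u + f v)) i) = (\<Sum>i\<in>I. q i * f i)"
    for f :: "'i \<Rightarrow> int"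
    unfolding sum_remove2[OF I uv(1-3), of "\<lambda>i. (q(u := q u - q v)) i * (f(v := f u + f v)) i"] rest
      sum_remove2[OF I uv(1-3), of "\<lambda>i. q i * f i"]
    using uv by (simp add: algebra_simps)
  have a: "(\<Sum>i\<in>I. (q(u := q u - q v)) i * (a(v := \<lambda>j. a u j + a v j)) i j) = (\<Sum>i\<in>I. q i * a i j)" for j
    unfolding key[of "\<lambda>i. a i j", symmetric] by (intro sum.cong) auto
  have d: "(\<Sum>i\<in>I. (q(u := q u - q v)) i * int ((d(v := d u + d v)) i)) = (\<Sum>i\<in>I. q i * int (d i))"
    unfolding key[of "\<lambda>i. int (d i)", symmetric] by (intro sum.cong) auto
  show ?thesis
    using adm uv unfolding admissible_def a d by auto
qed

lemma admissible_merge: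
  fixes q :: "'i \<Rightarrow> int"
  assumes I: "finite I" and uv: "u \<in> I" "v \<in> I" "u \<noteq> v" "q u = q v"
    and adm: "admissible I J a d q"
  shows "admissible (I - {v}) J (a(u := \<lambda>j. a u j + a v j)) (d(u := d u + d v)) q"
proof -
  have key: "(\<Sum>i\<in>I - {v}. q i * (f(u := f u + f v)) i) = (\<Sum>i\<in>I. q i * f i)"
    for f :: "'i \<Rightarrow> int"
  proof -
    have "(\<Sum>i\<in>I - {v} - {u}. q i * (f(u := f u + f v)) i) = (\<Sum>i\<in>I - {v} - {u}. q i * f i)"
      by (intro sum.cong) auto
    moreover have "(\<Sum>i\<in>I. q i * f i) = q v * f v + (q u * f u + (\<Sum>i\<in>I - {v} - {u}. q i * f i))"
      using I uv by (intro sum_remove2) auto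
    moreover have "(\<Sum>i\<in>I - {v}. q i * (f(u := f u + f v)) i)
        = q u * (f u + f v) + (\<Sum>i\<in>I - {v} - {u}. q i * (f(u := f u + f v)) i)"
      using I uv by (subst sum.remove[of "I - {v}" u]) auto
    ultimately show ?thesis using uv by (simp add: algebra_simps)
  qed
  have a: "(\<Sum>i\<in>I - {v}. q i * (a(u := \<lambda>j. a u j + a v j)) i j) = (\<Sum>i\<in>I. q i * a i j)" for j
    unfolding key[of "\<lambda>i. a i j", symmetric] by (intro sum.cong) auto
  have d: "(\<Sum>i\<in>I - {v}. q i * int ((d(u := d u + d v)) i)) = (\<Sum>i\<in>I. q i * int (d i))"
    unfolding key[of "\<lambda>i. int (d i)", symmetric] by (intro sum.cong) auto
  show ?thesis
    using adm uv unfolding admissible_def a d by auto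
qed

text \<open>A large multiple of \<open>q\<close> plus a solution that separates u from v stays in
  the solution space and has the same signs, hence the same solution sets, but breaks the
  tie.\<close>

lemma admissible_perturb:
  fixes q :: "'i \<Rightarrow> int"
  assumes I: "finite I" and uv: "u \<in> I" "v \<in> I" "q u = q v"
    and adm: "admissible I J a d q" and c: "c \<in> solutions I J a d q s" "c u \<noteq> c v"
  obtains q' where "admissible I J a d q'" "q' u \<noteq> q' v" "\<And>i. i \<in> I \<Longrightarrow> q' i < 0 \<longleftrightarrow> q i < 0"
proof -
  define K where "K = 1 + (\<Sum>i\<in>I. int (c i))"
  define q' where "q' i = K * q i + int (c i)" for i
  have cK: "int (c i) < K" if "i \<in> I" for i
    using member_le_sum[of i I "\<lambda>i. int (c i)"] that I by (simp add: K_def)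
  have K: "K > 0" by (simp add: K_def sum_nonneg add_pos_nonneg)
  have sgn: "q' i \<noteq> 0 \<and> (q' i < 0 \<longleftrightarrow> q i < 0)" if i: "i \<in> I" for i
  proof -
    have "q i \<noteq> 0" using adm i by (simp add: admissible_def)
    then consider "q i \<ge> 1" | "q i \<le> -1" by linarith
    then show ?thesis
    proof cases
      case 1
      then have "K * q i > 0" using K by simp
      then show ?thesis using 1 by (auto simp: q'_def)
    next
      case 2
      then have "K * q i \<le> K * (-1)" using K by (intro mult_left_mono) auto
      then show ?thesis using cK[OF i] 2 by (auto simp: q'_def)
    qed
  qed
  have lin: "(\<Sum>i\<in>I. q' i * f i) = K * (\<Sum>i\<in>I. q i * f i) + (\<Sum>i\<in>I. int (c i) * f i)"
    for f :: "'i \<Rightarrow> int"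
    by (simp add: q'_def sum.distrib sum_distrib_left algebra_simps)
  have "(\<Sum>i\<in>I. q' i * int (d i)) > 0"
    unfolding lin using K adm by (intro add_pos_nonneg sum_nonneg) (auto simp: admissible_def)
  then have "admissible I J a d q'"
    using adm c sgn by (auto simp: admissible_def lin solutions_def)
  moreover have "q' u \<noteq> q' v" using uv c by (simp add: q'_def)
  ultimately show thesis using that sgn by blast
qed

section \<open>Termination of the reduction\<close>

lemma quasipolynomial_counts_split:
  assumes I: "finite I" and uv: "u \<in> I" "v \<in> I" "u \<noteq> v"
    and v: "quasipolynomial_counts I J (a(v := \<lambda>j. a u j + a v j))"
    and u: "quasipolynomial_counts I J (a(u := \<lambda>j. a u j + a v j))"
    and merge: "quasipolynomial_counts (I - {v}) J (a(u := \<lambda>j. a u j + a v j))"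
  shows "quasipolynomial_counts I J a"
proof -
  have split: "quasipolynomial (\<lambda>s. of_nat (card (solutions I J a d q s)))"
    if adm: "admissible I J a d q" and q: "q u \<noteq> q v" for d q
  proof -
    have d: "\<And>i. i \<in> I \<Longrightarrow> d i > 0" using adm by (simp add: admissible_def)
    have "admissible I J (a(u := \<lambda>j. a u j + a v j)) (d(u := d u + d v)) (q(v := q v - q u))"
      using admissible_split[OF I uv(2,1) _ _ adm] uv q by (simp add: add.commute)
    then have "quasipolynomial (\<lambda>s. of_nat (card
        (solutions I J (a(u := \<lambda>j. a u j + a v j)) (d(u := d u + d v)) (q(v := q v - q u)) s)))"
      using u by (simp add: quasipolynomial_counts_def)
    moreover have "quasipolynomial (\<lambda>s. of_nat (card
        (solutions I J (a(v := \<lambda>j. a u j + a v j)) (d(v := d u + d v)) (q(u := q u - q v)) s)))"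
      using v admissible_split[OF I uv q adm] by (simp add: quasipolynomial_counts_def)
    moreover have "card (solutions I J a d q s)
        = card (solutions I J (a(v := \<lambda>j. a u j + a v j)) (d(v := d u + d v)) (q(u := q u - q v)) s)
        + card (solutions I J (a(u := \<lambda>j. a u j + a v j)) (d(u := d u + d v)) (q(v := q v - q u)) s)"
      for s using I d uv q by (rule card_solutions_split)
    ultimately show ?thesis by (simp only: of_nat_add quasipolynomial_add)
  qed
  show ?thesis
    unfolding quasipolynomial_counts_def
  proof (intro allI impI)
    fix d q assume adm: "admissible I J a d q"
    \<comment> \<open>A tie is broken by perturbing \<open>q\<close> with a solution that separates
      u and v; if there is none, u and v are merged.\<close>
    consider "q u \<noteq> q v" | s c where "q u = q v" "c \<in> solutions I J a d q s" "c u \<noteq> c v"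
      | "q u = q v" "\<And>s c. c \<in> solutions I J a d q s \<Longrightarrow> c u = c v" by blast
    then show "quasipolynomial (\<lambda>s. of_nat (card (solutions I J a d q s)))"
    proof cases
      case 1
      then show ?thesis using split adm by blast
    next
      case 2
      obtain q' where q': "admissible I J a d q'" "q' u \<noteq> q' v" "\<And>i. i \<in> I \<Longrightarrow> q' i < 0 \<longleftrightarrow> q i < 0"
        using admissible_perturb[OF I uv(1,2) 2(1) adm 2(2,3)] by blast
      have "solutions I J a d q s = solutions I J a d q' s" for s
        using q'(3) by (auto simp: solutions_def)
      then show ?thesis using split[OF q'(1,2)] by simp
    next
      case 3
      have "card (solutions I J a d q s)
          = card (solutions (I - {v}) J (a(u := \<lambda>j. a u j + a v j)) (d(u := d u + d v)) q s)" for s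
        using I uv 3 by (rule card_solutions_merge)
      then show ?thesis
        using merge admissible_merge[OF I uv 3(1) adm] by (simp only: quasipolynomial_counts_def)
    qed
  qed
qed

lemma quasipolynomial_counts_zero_row:
  assumes "quasipolynomial_counts I J a" "\<And>i. i \<in> I \<Longrightarrow> a i w = 0"
  shows "quasipolynomial_counts I (insert w J) a"
proof -
  have "solutions I (insert w J) a d q = solutions I J a d q" for d q
    using assms(2) by (auto simp: solutions_def fun_eq_iff)
  then show ?thesis using assms(1) by (auto simp: quasipolynomial_counts_def admissible_def)
qed

text \<open>Nonnegative solutions vanish wherever row w has a nonzero coefficient, whereas
  \<open>q\<close>, nonzero everywhere, can balance the row only by being negative at such a
  position. The facet there is removed, so nothing remains, not even the zero array.\<close>

lemma quasipolynomial_counts_one_signed_row: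
  assumes I: "finite I" and w: "w \<in> J" and u: "u \<in> I" "a u w \<noteq> 0"
    and sgn: "\<And>i. i \<in> I \<Longrightarrow> a i w * a u w \<ge> 0"
  shows "quasipolynomial_counts I J a"
  unfolding quasipolynomial_counts_def
proof (intro allI impI)
  fix d q assume adm: "admissible I J a d q"
  have zero: "(\<Sum>i\<in>I. x i * (a i w * a u w)) = 0" if "(\<Sum>i\<in>I. x i * a i w) = 0" for x :: "'a \<Rightarrow> int"
  proof -
    have "(\<Sum>i\<in>I. x i * (a i w * a u w)) = (\<Sum>i\<in>I. x i * a i w) * a u w"
      unfolding sum_distrib_right mult.assoc ..
    then show ?thesis using that by simp
  qed
  have "\<exists>i\<in>I. q i < 0 \<and> a i w \<noteq> 0"
  proof (rule ccontr)
    assume "\<not> ?thesis"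
    then have "\<And>i. i \<in> I \<Longrightarrow> q i * (a i w * a u w) \<ge> 0"
      using sgn by (metis linorder_not_less mult_nonneg_nonneg mult_zero_left mult_zero_right order_refl)
    then have "q u * (a u w * a u w) = 0"
      using zero[of q] adm w I u sum_nonneg_eq_0_iff[of I "\<lambda>i. q i * (a i w * a u w)"]
      by (auto simp: admissible_def)
    then show False using u adm by (auto simp: admissible_def)
  qed
  then obtain i where i: "i \<in> I" "q i < 0" "a i w \<noteq> 0" by blast
  have "solutions I J a d q s = {}" for s
  proof (rule ccontr)
    assume "solutions I J a d q s \<noteq> {}"
    then obtain c where c: "c \<in> solutions I J a d q s" by blast
    then have "int (c i) * (a i w * a u w) = 0"
      using zero[of "\<lambda>i. int (c i)"] w I i sgn sum_nonneg_eq_0_iff[of I "\<lambda>i. int (c i) * (a i w * a u w)"]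
      by (auto simp: solutions_def)
    moreover have "c i > 0" using c i by (auto simp: solutions_def)
    ultimately show False using i u by simp
  qed
  then show "quasipolynomial (\<lambda>s. of_nat (card (solutions I J a d q s)))"
    by (simp add: quasipolynomial_zero)
qed

lemma abs_add_less_of_opposite_signs:
  fixes x y :: int
  assumes "x * y < 0" "\<bar>x\<bar> \<le> B" "\<bar>y\<bar> \<le> B"
  shows "\<bar>x + y\<bar> < B"
  using assms by (auto simp: mult_less_0_iff)

text \<open>Three nested inductions: on the bound for row w, on the number of coefficients attaining
  it, and on the number of those opposed in sign to a maximal one at u. Adding u and an opposed v
  gives a smaller coefficient: placed at u it lowers the second number, placed at v the third. When
  none is opposed, the row has one sign.\<close>

lemma quasipolynomial_counts_insert_row:
  fixes I :: "'i set" and J :: "'j set"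
  assumes J: "\<And>(I :: 'i set) a. finite I \<Longrightarrow> quasipolynomial_counts I J a"
    and "finite I" "\<And>i. i \<in> I \<Longrightarrow> \<bar>a i w\<bar> \<le> int B"
  shows "quasipolynomial_counts I (insert w J) a"
  using assms(2,3)
proof (induction B arbitrary: I a)
  case 0
  then show ?case by (intro quasipolynomial_counts_zero_row J) auto
next
  case (Suc B)
  define top where "top I a = {i \<in> I. \<bar>a i w\<bar> = int (Suc B)}" for I :: "'i set" and a :: "'i \<Rightarrow> 'j \<Rightarrow> int"
  define opp where "opp I a u = {i \<in> I. a i w * a u w < 0}" for I :: "'i set" and a :: "'i \<Rightarrow> 'j \<Rightarrow> int" and u
  have "quasipolynomial_counts I (insert w J) a"
    if "finite I" "\<And>i. i \<in> I \<Longrightarrow> \<bar>a i w\<bar> \<le> int (Suc B)" "card (top I a) \<le> n" for n I a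
    using that
  proof (induction n arbitrary: I a)
    case (0 I a)
    then have "top I a = {}" by (simp add: top_def)
    then have "\<bar>a i w\<bar> \<le> int B" if "i \<in> I" for i
      using that 0(2)[OF that] by (auto simp: top_def)
    then show ?case using 0(1) Suc.IH by blast
  next
    case (Suc n I a)
    show ?case
    proof (cases "top I a = {}")
      case True
      then show ?thesis using Suc by simp
    next
      case False
      then obtain u where u: "u \<in> I" "\<bar>a u w\<bar> = int (Suc B)" by (auto simp: top_def)
      show ?thesis using Suc.prems u
      proof (induction "card (opp I a u)" arbitrary: a rule: less_induct)
        case (less a)
        note fin = less.prems(1) and bound = less.prems(2)
        show ?case
        proof (cases "opp I a u = {}")
          case True
          then have "a i w * a u w \<ge> 0" if "i \<in> I" for i using that by (force simp: opp_def)
          then show ?thesis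
            using fin less.prems by (intro quasipolynomial_counts_one_signed_row[of _ w _ u]) auto
        next
          case False
          then obtain v where v: "v \<in> I" "a v w * a u w < 0" by (auto simp: opp_def)
          then have uv: "u \<noteq> v" by (metis linorder_not_less zero_le_square)
          define y where "y j = a u j + a v j" for j
          have y: "\<bar>y w\<bar> < int (Suc B)"
            unfolding y_def using v bound less.prems(4)
            by (intro abs_add_less_of_opposite_signs) (auto simp: mult.commute)
          \<comment> \<open>As a u w is maximal in absolute value, the sum keeps its sign or is 0;
            thus v is no longer opposed to u.\<close>
          have yu: "y w * a u w \<ge> 0"
          proof -
            have "\<bar>a v w\<bar> \<le> \<bar>a u w\<bar>" using bound[OF v(1)] less.prems(5) by simp
            then show ?thesis unfolding y_def using v(2)
              by (auto simp: mult_less_0_iff zero_le_mult_iff)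
          qed
          have top_u: "u \<in> top I a" using less.prems by (simp add: top_def)
          have "quasipolynomial_counts I (insert w J) (a(v := y))"
          proof (rule less.hyps)
            have "opp I (a(v := y)) u \<subseteq> opp I a u - {v}" using yu uv by (auto simp: opp_def)
            moreover have "v \<in> opp I a u" using v by (simp add: opp_def)
            ultimately have "opp I (a(v := y)) u \<subset> opp I a u" by blast
            then show "card (opp I (a(v := y)) u) < card (opp I a u)"
              using fin by (intro psubset_card_mono) (auto simp: opp_def)
            have "top I (a(v := y)) \<subseteq> top I a" using y by (auto simp: top_def)
            then show "card (top I (a(v := y))) \<le> Suc n"
              using fin less.prems(3) card_mono[of "top I a" "top I (a(v := y))"] by (simp add: top_def)
          qed (use less.prems bound y uv in auto)
          \<comment> \<open>Stated for subsets so that it serves the split, on I, as well as the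
            merged system, on I - {v}.\<close>
          moreover have below: "quasipolynomial_counts I' (insert w J) (a(u := y))" if I': "I' \<subseteq> I" for I'
          proof (rule Suc.IH)
            have "top I' (a(u := y)) \<subset> top I a"
              using y top_u I' by (auto simp: top_def)
            then have "card (top I' (a(u := y))) < card (top I a)"
              using fin by (intro psubset_card_mono) (auto simp: top_def)
            then show "card (top I' (a(u := y))) \<le> n" using less.prems(3) by simp
            show "finite I'" using I' fin by (rule finite_subset)
            show "\<bar>(a(u := y)) i w\<bar> \<le> int (Suc B)" if "i \<in> I'" for i
              using that I' bound y by auto
          qed
          moreover have "(\<lambda>j. a u j + a v j) = y" by (simp add: y_def fun_eq_iff)
          ultimately show ?thesis
            using quasipolynomial_counts_split[OF fin less.prems(4) v(1) uv, of "insert w J" a]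
              below[of I] below[of "I - {v}"] by (simp only: order_refl Diff_subset simp_thms)
        qed
      qed
    qed
  qed
  then show ?case using Suc.prems by blast
qed

theorem quasipolynomial_counts_finite:
  assumes "finite J" "finite I"
  shows "quasipolynomial_counts I J a"
  using assms
proof (induction J arbitrary: I a)
  case (empty I a)
  show ?case
    unfolding quasipolynomial_counts_def
  proof (intro allI impI)
    fix d q assume adm: "admissible I {} a d q"
    \<comment> \<open>The positive total also excludes I = {}, whose count would be 1 at s = 0 and 0
      elsewhere.\<close>
    have "\<exists>i\<in>I. \<not> q i < 0"
    proof (rule ccontr)
      assume "\<not> ?thesis"
      then have "(\<Sum>i\<in>I. q i * int (d i)) \<le> 0" by (intro sum_nonpos) (auto simp: mult_nonpos_nonneg)
      then show False using adm by (simp add: admissible_def)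
    qed
    then show "quasipolynomial (\<lambda>s. of_nat (card (solutions I {} a d q s)))"
      using adm empty.prems by (auto simp: admissible_def intro: quasipolynomial_solutions_unconstrained)
  qed
next
  case (insert w J I a)
  have "\<bar>a i w\<bar> \<le> int (nat (\<Sum>i\<in>I. \<bar>a i w\<bar>))" if "i \<in> I" for i
    using member_le_sum[of i I "\<lambda>i. \<bar>a i w\<bar>"] that insert.prems by (simp add: sum_nonneg)
  then show ?case
    using insert.IH insert.prems
    by (intro quasipolynomial_counts_insert_row[where a = a and B = "nat (\<Sum>i\<in>I. \<bar>a i w\<bar>)"])
qed

section \<open>Magic hypercubes as solutions of a homogeneous system\<close>

text \<open>Lines are parametrizations, so that axis lines and diagonals form one family of
  equations; a diagonal appears once for each direction.\<close>

definition hc_lines :: "nat \<Rightarrow> nat \<Rightarrow> (nat \<Rightarrow> nat list) set" where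
  "hc_lines d n = (\<lambda>(v, k) i. v[k := i]) ` (hc_index d n \<times> {..<d}) \<union> diag_index d n ` Pow {..<d}"

lemma finite_hc_index: "finite (hc_index d n)"
  using finite_lists_length_eq[of "{1..n}" d] by (simp add: hc_index_def conj_commute)

lemma card_hc_index: "card (hc_index d n) = n ^ d"
  using card_lists_length_eq[of "{1..n}" d] by (simp add: hc_index_def conj_commute)

lemma finite_hc_lines: "finite (hc_lines d n)"
  by (simp add: hc_lines_def finite_hc_index)

lemma hc_index_update: "v \<in> hc_index d n \<Longrightarrow> i \<in> {1..n} \<Longrightarrow> v[k := i] \<in> hc_index d n"
  using set_update_subset_insert[of v k i] by (auto simp: hc_index_def)

lemma diag_index_in_hc_index: "i \<in> {1..n} \<Longrightarrow> diag_index d n R i \<in> hc_index d n"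
  by (auto simp: hc_index_def diag_index_def)

lemma hc_lines_in_hc_index: "L \<in> hc_lines d n \<Longrightarrow> i \<in> {1..n} \<Longrightarrow> L i \<in> hc_index d n"
  by (auto simp: hc_lines_def hc_index_update diag_index_in_hc_index simp del: One_nat_def)

lemma magic_hypercube_iff_lines:
  "magic_hypercube d n s x \<longleftrightarrow>
     (\<forall>v\<in>hc_index d n. x v \<ge> 0) \<and> (\<forall>L\<in>hc_lines d n. (\<Sum>i=1..n. x (L i)) = s)"
  by (auto simp: magic_hypercube_def semi_magic_hypercube_def hc_lines_def simp del: One_nat_def)

lemma sum_hc_index_Suc:
  "(\<Sum>v\<in>hc_index (Suc d) n. f v) = (\<Sum>v\<in>hc_index d n. \<Sum>i=1..n. f (i # v))"
proof -
  have "(\<Sum>v\<in>hc_index d n. \<Sum>i=1..n. f (i # v)) = (\<Sum>(v, i)\<in>hc_index d n \<times> {1..n}. f (i # v))"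
    by (simp add: sum.cartesian_product)
  also have "\<dots> = (\<Sum>v\<in>hc_index (Suc d) n. f v)"
    by (rule sum.reindex_bij_witness[where i = "\<lambda>v. (tl v, hd v)" and j = "\<lambda>(v, i). i # v"])
       (auto simp: hc_index_def length_Suc_conv)
  finally show ?thesis by simp
qed

lemma magic_hypercube_total:
  assumes "magic_hypercube (Suc d) n s x" "n > 0"
  shows "(\<Sum>v\<in>hc_index (Suc d) n. x v) = of_nat (n ^ d) * s"
proof -
  have "(\<Sum>i=1..n. x (i # v)) = s" if v: "v \<in> hc_index d n" for v
  proof -
    have "1 # v \<in> hc_index (Suc d) n" using v assms(2) by (simp add: hc_index_def)
    then have "(\<Sum>i=1..n. x ((1 # v)[0 := i])) = s"
      using assms(1) unfolding magic_hypercube_def semi_magic_hypercube_def by blast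
    then show ?thesis by simp
  qed
  then have "(\<Sum>v\<in>hc_index (Suc d) n. x v) = (\<Sum>v\<in>hc_index d n. s)"
    unfolding sum_hc_index_Suc by (intro sum.cong) auto
  also have "\<dots> = of_nat (n ^ d) * s"
    by (simp only: sum_constant card_hc_index)
  finally show ?thesis .
qed

text \<open>
  The magic sum is eliminated: a line sum equals \<open>s\<close> iff \<open>n ^ d\<close> times it equals the sum of all
  entries, which for a magic hypercube of dimension \<open>d + 1\<close> is \<open>n ^ d * s\<close>.
\<close>

definition line_coefficient :: "nat \<Rightarrow> nat \<Rightarrow> nat list \<Rightarrow> (nat \<Rightarrow> nat list) \<Rightarrow> int" where
  "line_coefficient d n w L = int (n ^ d) * (\<Sum>i=1..n. if L i = w then 1 else 0) - 1"

lemma sum_line_coefficient: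
  assumes "L \<in> hc_lines (Suc d) n"
  shows "(\<Sum>w\<in>hc_index (Suc d) n. f w * line_coefficient d n w L)
    = int (n ^ d) * (\<Sum>i=1..n. f (L i)) - (\<Sum>w\<in>hc_index (Suc d) n. f w)"
proof -
  let ?I = "hc_index (Suc d) n"
  have "(\<Sum>w\<in>?I. f w * (\<Sum>i=1..n. if L i = w then 1 else 0))
      = (\<Sum>i=1..n. \<Sum>w\<in>?I. f w * (if L i = w then 1 else 0))"
    by (simp only: sum_distrib_left) (rule sum.swap)
  also have "\<dots> = (\<Sum>i=1..n. f (L i))"
    using hc_lines_in_hc_index[OF assms]
    by (intro sum.cong refl) (simp add: if_distrib finite_hc_index cong: if_cong)
  finally have "(\<Sum>w\<in>?I. f w * (\<Sum>i=1..n. if L i = w then 1 else 0)) = (\<Sum>i=1..n. f (L i))" .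
  moreover have "(\<Sum>w\<in>?I. f w * line_coefficient d n w L)
      = int (n ^ d) * (\<Sum>w\<in>?I. f w * (\<Sum>i=1..n. if L i = w then 1 else 0)) - (\<Sum>w\<in>?I. f w)"
    unfolding line_coefficient_def right_diff_distrib sum_subtractf sum_distrib_left
    by (simp add: mult.left_commute)
  ultimately show ?thesis by simp
qed

lemma magic_hypercubes_eq_solutions:
  assumes n: "n > 0"
  shows "{x \<in> extensional (hc_index (Suc d) n). magic_hypercube (Suc d) n s x}
    = solutions (hc_index (Suc d) n) (hc_lines (Suc d) n) (line_coefficient d n) (\<lambda>_. 1) (\<lambda>_. 1) (n ^ d * s)"
proof -
  let ?I = "hc_index (Suc d) n" and ?J = "hc_lines (Suc d) n"
  have "magic_hypercube (Suc d) n s x \<longleftrightarrow>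
      (\<forall>L\<in>?J. (\<Sum>w\<in>?I. int (x w) * line_coefficient d n w L) = 0) \<and> (\<Sum>w\<in>?I. x w) = n ^ d * s" for x
  proof
    assume x: "magic_hypercube (Suc d) n s x"
    have total: "(\<Sum>w\<in>?I. x w) = n ^ d * s" using magic_hypercube_total[OF x n] by simp
    have "(\<Sum>w\<in>?I. int (x w) * line_coefficient d n w L) = 0" if L: "L \<in> ?J" for L
    proof -
      have "(\<Sum>i=1..n. x (L i)) = s" using x L by (simp add: magic_hypercube_iff_lines)
      then show ?thesis
        using total unfolding sum_line_coefficient[OF L] of_nat_sum[symmetric] by simp
    qed
    then show "(\<forall>L\<in>?J. (\<Sum>w\<in>?I. int (x w) * line_coefficient d n w L) = 0)
        \<and> (\<Sum>w\<in>?I. x w) = n ^ d * s"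
      using total by blast
  next
    assume x: "(\<forall>L\<in>?J. (\<Sum>w\<in>?I. int (x w) * line_coefficient d n w L) = 0)
        \<and> (\<Sum>w\<in>?I. x w) = n ^ d * s"
    have "(\<Sum>i=1..n. x (L i)) = s" if L: "L \<in> ?J" for L
    proof -
      have "int (n ^ d) * int (\<Sum>i=1..n. x (L i)) - int (n ^ d * s) = 0"
        using x L sum_line_coefficient[OF L, of "\<lambda>w. int (x w)"] by (simp only: of_nat_sum[symmetric])
      then have "int (n ^ d) * int (\<Sum>i=1..n. x (L i)) = int (n ^ d) * int s" by simp
      then show ?thesis using n by (simp add: of_nat_sum[symmetric] del: of_nat_sum)
    qed
    then show "magic_hypercube (Suc d) n s x" by (simp add: magic_hypercube_iff_lines)
  qed
  then show ?thesis by (auto simp: solutions_def)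
qed

theorem quasipolynomial_magic_hypercubes:
  assumes n: "n > 0"
  shows "quasipolynomial (\<lambda>s. of_nat (card
    {x :: nat list \<Rightarrow> nat. x \<in> extensional (hc_index (Suc d) n) \<and> magic_hypercube (Suc d) n s x}))"
proof -
  let ?I = "hc_index (Suc d) n"
  \<comment> \<open>The all-ones array solves each equation: a line has n entries, and n ^ d * n is
    the number of all positions.\<close>
  have "(\<Sum>w\<in>?I. line_coefficient d n w L) = 0" if "L \<in> hc_lines (Suc d) n" for L
    using sum_line_coefficient[OF that, of "\<lambda>_. 1"] by (simp add: card_hc_index)
  then have "admissible ?I (hc_lines (Suc d) n) (line_coefficient d n) (\<lambda>_. 1) (\<lambda>_. 1)"
    using n by (simp add: admissible_def card_hc_index)
  then have "quasipolynomial (\<lambda>s. of_nat (card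
      (solutions ?I (hc_lines (Suc d) n) (line_coefficient d n) (\<lambda>_. 1) (\<lambda>_. 1) s)))"
    using quasipolynomial_counts_finite[OF finite_hc_lines finite_hc_index]
    unfolding quasipolynomial_counts_def by blast
  \<comment> \<open>Solutions are graded by the sum of all entries, which is n ^ d * s for magic sum
    s.\<close>
  then have "quasipolynomial (\<lambda>s. of_nat (card
      (solutions ?I (hc_lines (Suc d) n) (line_coefficient d n) (\<lambda>_. 1) (\<lambda>_. 1) (n ^ d * s))))"
    by (rule quasipolynomial_scale_argument)
  then show ?thesis by (simp only: magic_hypercubes_eq_solutions[OF n, symmetric])
qed

section \<open>The degree of a quasipolynomial\<close>

lemma poly_dominates_power:
  fixes p :: "complex poly"
  assumes "degree p > D"
  shows "\<exists>r. \<forall>z. r \<le> norm z \<longrightarrow> b * norm z ^ D \<le> norm (poly p z)"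
  using assms
proof (induction D arbitrary: p b)
  case 0
  obtain a q where p: "p = pCons a q" by (cases p)
  have "q \<noteq> 0" using 0 p by auto
  then show ?case using poly_infinity[of q b a] p by auto
next
  case (Suc D)
  obtain a q where p: "p = pCons a q" by (cases p)
  have "degree q > D" using Suc.prems p by (auto split: if_splits)
  \<comment> \<open>The extra 1 yields a further norm z ^ (D + 1), which absorbs the constant
    coefficient \<open>a\<close>.\<close>
  then obtain r where r: "\<And>z. r \<le> norm z \<Longrightarrow> (b + 1) * norm z ^ D \<le> norm (poly q z)"
    using Suc.IH[of q "b + 1"] by blast
  have "b * norm z ^ Suc D \<le> norm (poly p z)" if z: "max r (max 1 (norm a)) \<le> norm z" for z
  proof -
    have "norm a \<le> norm z * norm z ^ D"
    proof -
      have "norm a * 1 \<le> norm z * norm z ^ D"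
        using z by (intro mult_mono one_le_power) auto
      then show ?thesis by simp
    qed
    moreover have "norm z * ((b + 1) * norm z ^ D) \<le> norm z * norm (poly q z)"
      using z by (intro mult_left_mono r) auto
    moreover have "norm z * norm (poly q z) - norm a \<le> norm (poly p z)"
      using norm_diff_ineq[of "z * poly q z" a] by (simp add: p norm_mult add.commute)
    ultimately show ?thesis by (simp add: algebra_simps)
  qed
  then show ?case by blast
qed

lemma norm_poly_le_power:
  fixes p :: "complex poly"
  assumes "degree p \<le> D" "norm z \<ge> 1"
  shows "norm (poly p z) \<le> (\<Sum>i\<le>degree p. norm (coeff p i)) * norm z ^ D"
proof -
  have "norm (poly p z) \<le> (\<Sum>i\<le>degree p. norm (coeff p i) * norm z ^ i)"
    unfolding poly_altdef by (rule sum_norm_le) (simp add: norm_mult norm_power)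
  also have "\<dots> \<le> (\<Sum>i\<le>degree p. norm (coeff p i) * norm z ^ D)"
    using assms by (intro sum_mono mult_left_mono power_increasing) auto
  finally show ?thesis by (simp add: sum_distrib_right)
qed

lemma degree_le_if_bounded_on_progression:
  fixes p :: "complex poly"
  assumes N: "N > 0"
    and bound: "\<And>m. norm (poly p (of_nat (i + N * m))) \<le> C * real (i + N * m + 1) ^ D"
  shows "degree p \<le> D"
proof (rule ccontr)
  assume "\<not> degree p \<le> D"
  \<comment> \<open>The factor 2 ^ D pays for s + 1 \<le> 2 * s; the extra 1 makes the contradiction
    strict.\<close>
  then obtain r where r: "\<And>z. r \<le> norm z \<Longrightarrow> (\<bar>C\<bar> * 2 ^ D + 1) * norm z ^ D \<le> norm (poly p z)"
    using poly_dominates_power[of D p "\<bar>C\<bar> * 2 ^ D + 1"] by auto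
  obtain m where m: "real m \<ge> max r 1" using real_arch_simple by blast
  define s where "s = i + N * m"
  have "1 * m \<le> N * m" using N by (intro mult_le_mono1) simp
  then have "m \<le> s" unfolding s_def by linarith
  then have s: "r \<le> real s" "1 \<le> real s" using m by auto
  have "C * real (s + 1) ^ D \<le> \<bar>C\<bar> * (2 * real s) ^ D"
    using s by (intro mult_mono power_mono) auto
  moreover have "(\<bar>C\<bar> * 2 ^ D + 1) * real s ^ D \<le> C * real (s + 1) ^ D"
    using r[of "of_nat s"] s(1) bound[of m, folded s_def] by simp
  moreover have "real s ^ D > 0" using s by simp
  ultimately show False by (simp add: power_mult_distrib algebra_simps)
qed

lemma degree_ge_if_large_on_multiples:
  fixes p :: "complex poly"
  assumes c: "c > 0" and N: "N > 0"
    and large: "\<And>m. m > 0 \<Longrightarrow> c * real m ^ D \<le> norm (poly p (of_nat (N * m)))"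
  shows "degree p \<ge> D"
proof (rule ccontr)
  assume "\<not> degree p \<ge> D"
  then obtain E where D: "D = Suc E" "degree p \<le> E" by (cases D) auto
  define M where "M = (\<Sum>i\<le>degree p. norm (coeff p i))"
  obtain m :: nat where m: "real m > M * real N ^ E / c" using reals_Archimedean2 by blast
  have "M \<ge> 0" by (simp add: M_def sum_nonneg)
  then have "real m > 0" using m c by (meson divide_nonneg_pos le_less_trans mult_nonneg_nonneg of_nat_0_le_iff zero_le_power)
  then have m0: "m > 0" by simp
  have "N * m > 0" using N m0 by simp
  then have "1 \<le> norm (of_nat (N * m) :: complex)" unfolding norm_of_nat by linarith
  from norm_poly_le_power[OF D(2) this] large[OF m0]
  have "c * real m ^ D \<le> M * real (N * m) ^ E" unfolding M_def norm_of_nat by (rule order_trans[rotated])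
  then have "(c * real m) * real m ^ E \<le> (M * real N ^ E) * real m ^ E"
    by (simp add: D power_mult_distrib mult_ac)
  then have "c * real m \<le> M * real N ^ E" using m0 by simp
  then show False using m c by (simp add: field_simps)
qed

text \<open>The upper bound limits every constituent. As the degree is a maximum, growth of one
  constituent suffices, here that of residue 0, which governs the multiples of K * N.\<close>

lemma quasipolynomial_of_degreeI:
  assumes f: "quasipolynomial f"
    and upper: "\<And>s. norm (f s) \<le> C * real (s + 1) ^ D"
    and c: "c > 0" and K: "K > 0"
    and lower: "\<And>m. m > 0 \<Longrightarrow> c * real m ^ D \<le> norm (f (K * m))"
  shows "quasipolynomial_of_degree f D"
proof -
  obtain N p where N: "N > 0" and p: "\<And>m. f m = poly (p (m mod N)) (of_nat m)"
    using quasipolynomialE[OF f] by metis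
  have "degree (p i) \<le> D" if "i < N" for i
  proof (rule degree_le_if_bounded_on_progression[OF N])
    show "norm (poly (p i) (of_nat (i + N * m))) \<le> C * real (i + N * m + 1) ^ D" for m
      using upper[of "i + N * m"] p[of "i + N * m"] that by simp
  qed
  moreover have "degree (p 0) \<ge> D"
  proof (rule degree_ge_if_large_on_multiples[OF c])
    show "K * N > 0" using K N by simp
    show "c * real m ^ D \<le> norm (poly (p 0) (of_nat (K * N * m)))" if "m > 0" for m
    proof -
      have "1 * m \<le> N * m" using N by (intro mult_le_mono1) simp
      then have "real m \<le> real (N * m)" unfolding of_nat_le_iff by simp
      then have "c * real m ^ D \<le> c * real (N * m) ^ D"
        using c by (intro mult_left_mono power_mono) auto
      also have "\<dots> \<le> norm (f (K * (N * m)))" using that N by (intro lower) simp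
      also have "f (K * (N * m)) = poly (p 0) (of_nat (K * N * m))"
        using p[of "K * (N * m)"] by (simp add: mult_ac)
      finally show ?thesis .
    qed
  qed
  ultimately have "Max ((\<lambda>i. degree (p i)) ` {..<N}) = D"
    using N by (intro Max_eqI) (auto intro!: image_eqI[of _ _ 0] antisym)
  moreover have "quasipolynomial_with f N p"
    using N p by (auto simp: quasipolynomial_with_def)
  ultimately show ?thesis unfolding quasipolynomial_of_degree_def by metis
qed

section \<open>Counting magic hypercubes of large magic sum\<close>

definition axis_balanced :: "nat \<Rightarrow> nat \<Rightarrow> (nat list \<Rightarrow> int) \<Rightarrow> bool" where
  "axis_balanced d n y \<longleftrightarrow> (\<forall>v\<in>hc_index d n. \<forall>k<d. (\<Sum>i=1..n. y (v[k := i])) = 0)"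

definition diag_sum :: "nat \<Rightarrow> nat \<Rightarrow> (nat list \<Rightarrow> int) \<Rightarrow> nat set \<Rightarrow> int" where
  "diag_sum d n y R = (\<Sum>i=1..n. y (diag_index d n R i))"

lemma axis_balanced_diff: "axis_balanced d n y \<Longrightarrow> axis_balanced d n z \<Longrightarrow> axis_balanced d n (\<lambda>v. y v - z v)"
  by (simp add: axis_balanced_def sum_subtractf)

lemma axis_balanced_lincomb:
  "(\<And>p. p \<in> P \<Longrightarrow> axis_balanced d n (b p)) \<Longrightarrow> axis_balanced d n (\<lambda>v. \<Sum>p\<in>P. t p * b p v)"
  unfolding axis_balanced_def
  by (auto simp: sum.swap[of _ P] sum_distrib_left[symmetric])

lemma diag_sum_diff: "diag_sum d n (\<lambda>v. y v - z v) R = diag_sum d n y R - diag_sum d n z R"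
  by (simp add: diag_sum_def sum_subtractf)

lemma diag_sum_lincomb:
  "diag_sum d n (\<lambda>v. \<Sum>p\<in>P. t p * b p v) R = (\<Sum>p\<in>P. t p * diag_sum d n (b p) R)"
  by (simp add: diag_sum_def sum.swap[of _ P] sum_distrib_left[symmetric])

lemma diag_sum_complement:
  assumes "R \<subseteq> {..<d}"
  shows "diag_sum d n y ({..<d} - R) = diag_sum d n y R"
  unfolding diag_sum_def
  by (rule sum.reindex_bij_witness[where i = "\<lambda>i. n + 1 - i" and j = "\<lambda>i. n + 1 - i"])
     (auto simp: diag_index_def intro!: arg_cong[where f = y])

text \<open>The slices through \<open>r\<close> are deleted, for variable \<open>r\<close>, because
  the block has to contain the pivot corners; deleting the slices of index n would remove
  them.\<close>

definition hc_block :: "nat \<Rightarrow> nat \<Rightarrow> nat list \<Rightarrow> nat list set" where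
  "hc_block d n r = {v \<in> hc_index d n. \<forall>k<d. v ! k \<noteq> r ! k}"

lemma card_hc_block:
  assumes "r \<in> hc_index d n"
  shows "card (hc_block d n r) = (n - 1) ^ d"
  using assms
proof (induction d arbitrary: r)
  case 0
  then show ?case by (simp add: hc_block_def hc_index_def cong: conj_cong)
next
  case (Suc d)
  obtain a r' where r: "r = a # r'" "a \<in> {1..n}" "r' \<in> hc_index d n"
    using Suc.prems by (auto simp: hc_index_def length_Suc_conv)
  have Cons_iff: "i # v \<in> hc_block (Suc d) n r \<longleftrightarrow> i \<in> {1..n} - {a} \<and> v \<in> hc_block d n r'" for i v
    unfolding hc_block_def hc_index_def r by (simp add: All_less_Suc2) blast
  have "v \<in> hc_block (Suc d) n r \<longleftrightarrow> v \<in> (\<lambda>(i, v). i # v) ` (({1..n} - {a}) \<times> hc_block d n r')" for v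
  proof (cases v)
    case Nil
    then show ?thesis by (auto simp: hc_block_def hc_index_def)
  next
    case (Cons i w)
    then show ?thesis using Cons_iff[of i w] by (auto simp: image_iff)
  qed
  then have "hc_block (Suc d) n r = (\<lambda>(i, v). i # v) ` (({1..n} - {a}) \<times> hc_block d n r')" by blast
  moreover have "inj_on (\<lambda>(i, v). i # v) (({1..n} - {a}) \<times> hc_block d n r')"
    by (auto simp: inj_on_def)
  ultimately show ?case
    using Suc.IH[OF r(3)] r(2) by (simp add: card_image card_cartesian_product)
qed

text \<open>Induction on the number k of leading coordinates that may agree with \<open>r\<close>.
  If the next coordinate agrees too, all other entries of the line in its direction are already
  known to vanish, and the line sum is 0.\<close>

lemma axis_balanced_eq_zero:
  assumes y: "axis_balanced d n y" and r: "r \<in> hc_index d n"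
    and block: "\<And>v. v \<in> hc_block d n r \<Longrightarrow> y v = 0" and v: "v \<in> hc_index d n"
  shows "y v = 0"
proof -
  have "y v = 0" if "v \<in> hc_index d n" "\<And>j. k \<le> j \<Longrightarrow> j < d \<Longrightarrow> v ! j \<noteq> r ! j" "k \<le> d" for k v
    using that
  proof (induction k arbitrary: v)
    case 0
    then show ?case by (intro block) (auto simp: hc_block_def)
  next
    case (Suc k)
    show ?case
    proof (cases "v ! k = r ! k")
      case False
      then show ?thesis using Suc by (metis Suc_leD Suc_leI le_neq_implies_less)
    next
      case True
      have len: "length v = d" using Suc.prems by (simp add: hc_index_def)
      have "v ! k \<in> {1..n}" using Suc.prems nth_mem[of k v] len by (auto simp: hc_index_def simp del: nth_mem)
      then have "(\<Sum>i=1..n. y (v[k := i])) = y v + (\<Sum>i\<in>{1..n} - {v ! k}. y (v[k := i]))"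
        by (subst sum.remove[of _ "v ! k"]) auto
      moreover have "y (v[k := i]) = 0" if "i \<in> {1..n} - {v ! k}" for i
      proof (rule Suc.IH)
        show "v[k := i] \<in> hc_index d n" using that Suc.prems by (intro hc_index_update) auto
        show "v[k := i] ! j \<noteq> r ! j" if "k \<le> j" "j < d" for j
          using that \<open>i \<in> {1..n} - {v ! k}\<close> True Suc.prems(2)[of j] len by (cases "j = k") auto
      qed (use Suc.prems in auto)
      ultimately show ?thesis
        using y Suc.prems by (simp add: axis_balanced_def)
    qed
  qed
  from this[of v d] show ?thesis using v by simp
qed

text \<open>The tensor product over k of the differences of the unit vectors at \<open>p ! k\<close>
  and \<open>r ! k\<close>: signs 1 and -1 on the vertices of the box spanned by \<open>p\<close>
  and \<open>r\<close>.\<close>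

definition box_array :: "nat \<Rightarrow> nat list \<Rightarrow> nat list \<Rightarrow> nat list \<Rightarrow> int" where
  "box_array d r p v = (\<Prod>k<d. of_bool (v ! k = p ! k) - of_bool (v ! k = r ! k))"

lemma axis_balanced_box_array:
  assumes "p \<in> hc_index d n" "r \<in> hc_index d n"
  shows "axis_balanced d n (box_array d r p)"
  unfolding axis_balanced_def
proof (intro ballI allI impI)
  fix v k assume v: "v \<in> hc_index d n" and k: "k < d"
  have pr: "p ! k \<in> {1..n}" "r ! k \<in> {1..n}"
    using assms k nth_mem[of k p] nth_mem[of k r] by (auto simp: hc_index_def simp del: nth_mem)
  have "box_array d r p (v[k := i])
      = (of_bool (i = p ! k) - of_bool (i = r ! k))
        * (\<Prod>j\<in>{..<d} - {k}. of_bool (v ! j = p ! j) - of_bool (v ! j = r ! j))" for i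
    unfolding box_array_def using k v
    by (subst prod.remove[of _ k]) (auto simp: hc_index_def intro!: arg_cong2[where f = "(*)"] prod.cong)
  moreover have "(\<Sum>i=1..n. of_bool (i = p ! k) - of_bool (i = r ! k) :: int) = 0"
    using pr by (simp add: sum_subtractf of_bool_def)
  ultimately show "(\<Sum>i=1..n. box_array d r p (v[k := i])) = 0"
    by (simp add: sum_distrib_right[symmetric])
qed

lemma box_array_on_block:
  assumes "p \<in> hc_block d n r" "v \<in> hc_block d n r"
  shows "box_array d r p v = of_bool (v = p)"
proof -
  have "box_array d r p v = (\<Prod>k<d. of_bool (v ! k = p ! k))"
    unfolding box_array_def using assms by (intro prod.cong) (auto simp: hc_block_def)
  also have "\<dots> = of_bool (\<forall>k<d. v ! k = p ! k)"
    by (auto simp: of_bool_def intro!: prod.neutral) 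
  also have "(\<forall>k<d. v ! k = p ! k) \<longleftrightarrow> v = p"
    using assms by (auto simp: hc_block_def hc_index_def list_eq_iff_nth_eq)
  finally show ?thesis .
qed

text \<open>
  The diagonals in \<open>K\<close> imply all others on balanced arrays, and the arrays \<open>box_array\<close> of the corners
  \<open>diag_index d n R 1\<close> are dual to them.  Hence the entries of the block other than these corners
  are coordinates on the space of balanced arrays with vanishing diagonal sums.
\<close>

locale diagonal_pivots =
  fixes d n :: nat and r :: "nat list" and K :: "nat set set"
  assumes d: "d > 0" and r: "r \<in> hc_index d n" and r_inner: "\<And>k. k < d \<Longrightarrow> r ! k \<noteq> 1 \<and> r ! k \<noteq> n"
    and K: "K \<subseteq> Pow {..<d}"
    and dual: "\<And>R R'. R \<in> K \<Longrightarrow> R' \<in> K \<Longrightarrow>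
      diag_sum d n (box_array d r (diag_index d n R 1)) R' = of_bool (R = R')"
    and dependent: "\<And>y R. axis_balanced d n y \<Longrightarrow> (\<And>R. R \<in> K \<Longrightarrow> diag_sum d n y R = 0) \<Longrightarrow>
      R \<subseteq> {..<d} \<Longrightarrow> diag_sum d n y R = 0"
begin

definition corner :: "nat set \<Rightarrow> nat list" where
  "corner R = diag_index d n R 1"

lemma diag_sum_box_corner:
  "R \<in> K \<Longrightarrow> R' \<in> K \<Longrightarrow> diag_sum d n (box_array d r (corner R)) R' = of_bool (R = R')"
  using dual by (simp only: corner_def)

definition free_positions :: "nat list set" where
  "free_positions = hc_block d n r - corner ` K"

lemma n_pos: "n > 0"
  using r d by (cases r) (auto simp: hc_index_def)

lemma finite_K: "finite K"
  using K by (rule finite_subset) simp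

lemma corner_in_block: "R \<in> K \<Longrightarrow> corner R \<in> hc_block d n r"
  using r_inner n_pos unfolding hc_block_def corner_def
  by (auto simp: diag_index_in_hc_index) (auto simp: diag_index_def split: if_splits)

lemma block_subset: "hc_block d n r \<subseteq> hc_index d n"
  by (auto simp: hc_block_def)

lemma free_subset: "free_positions \<subseteq> hc_index d n"
  using block_subset by (auto simp: free_positions_def)

lemma finite_free: "finite free_positions"
  using free_subset finite_hc_index by (rule finite_subset)

lemma inj_corner: "inj_on corner K"
proof (rule inj_onI)
  fix R R' assume R: "R \<in> K" "R' \<in> K" and eq: "corner R = corner R'"
  have "of_bool (R = R) = (of_bool (R' = R) :: int)"
    using diag_sum_box_corner[OF R(1) R(1)] diag_sum_box_corner[OF R(2) R(1)] unfolding eq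
    by (rule trans[OF sym])
  then have "R' = R" by simp
  then show "R = R'" by (rule sym)
qed

lemma card_free: "card free_positions = (n - 1) ^ d - card K"
proof -
  have "corner ` K \<subseteq> hc_block d n r" using corner_in_block by (rule image_subsetI)
  then have "card free_positions = card (hc_block d n r) - card (corner ` K)"
    unfolding free_positions_def using finite_K by (intro card_Diff_subset finite_imageI)
  then show ?thesis by (simp only: card_hc_block[OF r] card_image[OF inj_corner])
qed

text \<open>Subtracting the corner values times the corner arrays leaves a balanced array that
  vanishes on the whole block, hence everywhere. So y is a combination of corner arrays, and by
  duality its coefficients are its diagonal sums.\<close>

lemma balanced_zero_sums_eq_zero:
  assumes y: "axis_balanced d n y" and diag: "\<And>R. R \<in> K \<Longrightarrow> diag_sum d n y R = 0"
    and free: "\<And>v. v \<in> free_positions \<Longrightarrow> y v = 0" and v: "v \<in> hc_index d n"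
  shows "y v = 0"
proof -
  define z where "z v = y v - (\<Sum>R\<in>K. y (corner R) * box_array d r (corner R) v)" for v
  have corner: "corner R \<in> hc_index d n" if "R \<in> K" for R
    using corner_in_block[OF that] block_subset by blast
  have "axis_balanced d n z"
    unfolding z_def[abs_def]
    by (intro axis_balanced_diff axis_balanced_lincomb axis_balanced_box_array y corner r)
  moreover have "z v = 0" if v: "v \<in> hc_block d n r" for v
  proof -
    have "z v = y v - (\<Sum>R\<in>K. y (corner R) * of_bool (v = corner R))"
      unfolding z_def by (simp add: box_array_on_block[OF corner_in_block v])
    also have "\<dots> = 0"
    proof (cases "v \<in> corner ` K")
      case True
      then obtain R where R: "R \<in> K" "v = corner R" by blast
      have "(\<Sum>S\<in>K. y (corner S) * of_bool (v = corner S)) = (\<Sum>S\<in>K. if S = R then y (corner R) else 0)"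
        using R inj_corner by (intro sum.cong) (auto dest: inj_onD)
      then show ?thesis using R finite_K by simp
    next
      case False
      then have "y v = 0" using free v by (auto simp: free_positions_def)
      moreover have "(\<Sum>R\<in>K. y (corner R) * of_bool (v = corner R)) = 0"
        using False by (intro sum.neutral) auto
      ultimately show ?thesis by simp
    qed
    finally show ?thesis .
  qed
  ultimately have z: "z v = 0" if "v \<in> hc_index d n" for v
    using axis_balanced_eq_zero[OF _ r] that by blast
  have "y (corner R) = 0" if R: "R \<in> K" for R
  proof -
    have "diag_sum d n z R = 0"
      unfolding diag_sum_def using z by (intro sum.neutral) (auto simp: diag_index_in_hc_index)
    then have "0 = diag_sum d n y R - (\<Sum>S\<in>K. y (corner S) * diag_sum d n (box_array d r (corner S)) R)"
      unfolding z_def[abs_def] diag_sum_diff diag_sum_lincomb by simp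
    also have "(\<Sum>S\<in>K. y (corner S) * diag_sum d n (box_array d r (corner S)) R)
        = (\<Sum>S\<in>K. if S = R then y (corner R) else 0)"
      by (intro sum.cong refl) (simp add: diag_sum_box_corner[OF _ R])
    also have "\<dots> = y (corner R)" using R finite_K by simp
    finally show ?thesis using diag R by simp
  qed
  then show ?thesis using z[OF v] by (simp add: z_def)
qed

section \<open>Upper and lower bounds for the number of magic hypercubes\<close>

lemma magic_hypercube_entry_le:
  assumes x: "magic_hypercube d n s x" and v: "v \<in> hc_index d n"
  shows "x v \<le> (s :: nat)"
proof -
  have "v ! 0 \<in> {1..n}" using v d nth_mem[of 0 v] by (auto simp: hc_index_def simp del: nth_mem)
  then have "x (v[0 := v ! 0]) \<le> (\<Sum>i=1..n. x (v[0 := i]))" by (intro member_le_sum) auto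
  also have "\<dots> = s" using x v d unfolding magic_hypercube_def semi_magic_hypercube_def by blast
  finally show ?thesis by simp
qed

definition magic_arrays :: "nat \<Rightarrow> (nat list \<Rightarrow> nat) set" where
  "magic_arrays s = {x. x \<in> extensional (hc_index d n) \<and> magic_hypercube d n s x}"

lemma inj_on_restrict_free: "inj_on (\<lambda>x. restrict x free_positions) (magic_arrays s)"
proof (rule inj_onI)
  fix x x' assume x: "x \<in> magic_arrays s" and x': "x' \<in> magic_arrays s"
    and eq: "restrict x free_positions = restrict x' free_positions"
  define y where "y v = int (x v) - int (x' v)" for v
  have "y v = 0" if v: "v \<in> hc_index d n" for v
  proof (rule balanced_zero_sums_eq_zero[OF _ _ _ v])
    have ax: "(\<Sum>i=1..n. x (v[k := i])) = s"
      if "x \<in> magic_arrays s" "v \<in> hc_index d n" "k < d" for v k x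
      using that unfolding magic_arrays_def magic_hypercube_def semi_magic_hypercube_def by blast
    show "axis_balanced d n y"
      unfolding axis_balanced_def y_def sum_subtractf of_nat_sum[symmetric] using ax x x' by simp
    have di: "(\<Sum>i=1..n. x (diag_index d n R i)) = s"
      if "x \<in> magic_arrays s" "R \<in> K" for R x
      using that K unfolding magic_arrays_def magic_hypercube_def by blast
    show "diag_sum d n y R = 0" if "R \<in> K" for R
      unfolding diag_sum_def y_def sum_subtractf of_nat_sum[symmetric] using di x x' that by simp
    show "y v = 0" if "v \<in> free_positions" for v
      using fun_cong[OF eq, of v] that by (simp add: y_def)
  qed
  then show "x = x'"
    using x x' by (intro extensionalityI[of _ "hc_index d n"]) (auto simp: magic_arrays_def y_def)
qed

lemma restrict_free_in_PiE:
  "(\<lambda>x. restrict x free_positions) ` magic_arrays s \<subseteq> (\<Pi>\<^sub>E v\<in>free_positions. {0..s})"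
  using magic_hypercube_entry_le free_subset by (auto simp: magic_arrays_def)

lemma finite_magic_arrays: "finite (magic_arrays s)"
  by (rule inj_on_finite[OF inj_on_restrict_free restrict_free_in_PiE])
     (intro finite_PiE finite_free finite_atLeastAtMost)

lemma card_magic_arrays_le: "card (magic_arrays s) \<le> (s + 1) ^ card free_positions"
proof -
  have "card (magic_arrays s) \<le> card (\<Pi>\<^sub>E v\<in>free_positions. {0..s})"
    by (rule card_inj_on_le[OF inj_on_restrict_free restrict_free_in_PiE])
       (intro finite_PiE finite_free finite_atLeastAtMost)
  then show ?thesis using finite_free by (simp add: card_PiE)
qed

text \<open>A box array, corrected by corner arrays so that its diagonal sums in \<open>K\<close>
  vanish. Corner arrays are 0 at free positions, so the correction does not affect duality
  there.\<close>

definition free_array :: "nat list \<Rightarrow> nat list \<Rightarrow> int" where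
  "free_array p v = box_array d r p v
     - (\<Sum>R\<in>K. diag_sum d n (box_array d r p) R * box_array d r (corner R) v)"

lemma axis_balanced_free_array: "p \<in> free_positions \<Longrightarrow> axis_balanced d n (free_array p)"
  unfolding free_array_def[abs_def]
  using corner_in_block block_subset free_subset r
  by (intro axis_balanced_diff axis_balanced_lincomb axis_balanced_box_array) auto

lemma diag_sum_free_array:
  assumes p: "p \<in> free_positions" and R: "R \<subseteq> {..<d}"
  shows "diag_sum d n (free_array p) R = 0"
proof (rule dependent[OF axis_balanced_free_array[OF p] _ R])
  fix R assume R: "R \<in> K"
  have "(\<Sum>S\<in>K. diag_sum d n (box_array d r p) S * diag_sum d n (box_array d r (corner S)) R)
      = (\<Sum>S\<in>K. if S = R then diag_sum d n (box_array d r p) R else 0)"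
    by (intro sum.cong refl) (simp add: diag_sum_box_corner[OF _ R])
  then show "diag_sum d n (free_array p) R = 0"
    unfolding free_array_def[abs_def] diag_sum_diff diag_sum_lincomb using R finite_K by simp
qed

lemma free_array_on_free:
  assumes "p \<in> free_positions" "v \<in> free_positions"
  shows "free_array p v = of_bool (v = p)"
proof -
  have "box_array d r (corner R) v = 0" if "R \<in> K" for R
    using box_array_on_block[OF corner_in_block[OF that], of v] assms that by (auto simp: free_positions_def)
  then show ?thesis
    unfolding free_array_def using assms box_array_on_block[of p d n r v] by (simp add: free_positions_def)
qed

text \<open>The summand 1 keeps the bound positive, and thus n * \<open>free_array_bound\<close> a
  valid step for the magic sums.\<close>

definition free_array_bound :: nat where
  "free_array_bound = nat (\<Sum>p\<in>free_positions. \<Sum>v\<in>hc_index d n. \<bar>free_array p v\<bar>) + 1"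

lemma sum_free_array_le:
  assumes "v \<in> hc_index d n" "\<And>p. p \<in> free_positions \<Longrightarrow> t p \<le> m"
  shows "\<bar>\<Sum>p\<in>free_positions. int (t p) * free_array p v\<bar> \<le> int (free_array_bound * m)"
proof -
  have "\<bar>\<Sum>p\<in>free_positions. int (t p) * free_array p v\<bar>
      \<le> (\<Sum>p\<in>free_positions. \<bar>int (t p) * free_array p v\<bar>)" by (rule sum_abs)
  also have "\<dots> \<le> (\<Sum>p\<in>free_positions. int m * (\<Sum>v\<in>hc_index d n. \<bar>free_array p v\<bar>))"
    using assms finite_hc_index unfolding abs_mult
    by (intro sum_mono mult_mono member_le_sum) auto
  also have "\<dots> = (\<Sum>p\<in>free_positions. \<Sum>v\<in>hc_index d n. \<bar>free_array p v\<bar>) * int m"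
    by (simp add: sum_distrib_left mult.commute)
  also have "\<dots> \<le> int free_array_bound * int m"
    by (intro mult_right_mono) (auto simp: free_array_bound_def)
  finally show ?thesis by simp
qed

text \<open>The constant array \<open>free_array_bound * m\<close> is perturbed by the free arrays
  with coefficients in {1..m}: entries stay nonnegative by the bound, line and diagonal sums do not
  change, and the coefficients can be read off at the free positions.\<close>

lemma card_magic_arrays_ge: "m ^ card free_positions \<le> card (magic_arrays (n * free_array_bound * m))"
proof -
  define y where "y t v = int (free_array_bound * m) + (\<Sum>p\<in>free_positions. int (t p) * free_array p v)"
    for t :: "nat list \<Rightarrow> nat" and v
  define x where "x t = restrict (\<lambda>v. nat (y t v)) (hc_index d n)" for t
  let ?T = "\<Pi>\<^sub>E p\<in>free_positions. {1..m}"
  have nonneg: "y t v \<ge> 0" if "t \<in> ?T" "v \<in> hc_index d n" for t v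
    using sum_free_array_le[OF that(2), of t m] that(1) unfolding y_def by (auto simp: PiE_def Pi_def)
  have x: "int (x t v) = y t v" if "t \<in> ?T" "v \<in> hc_index d n" for t v
    using nonneg[OF that] that by (simp add: x_def)
  have line: "(\<Sum>i=1..n. x t (L i)) = n * free_array_bound * m"
    if t: "t \<in> ?T" and L: "\<And>i. i \<in> {1..n} \<Longrightarrow> L i \<in> hc_index d n"
      and zero: "\<And>p. p \<in> free_positions \<Longrightarrow> (\<Sum>i=1..n. free_array p (L i)) = 0" for t L
  proof -
    have "int (\<Sum>i=1..n. x t (L i)) = (\<Sum>i=1..n. y t (L i))"
      unfolding of_nat_sum by (intro sum.cong refl x t L)
    also have "\<dots> = int (n * free_array_bound * m)
        + (\<Sum>p\<in>free_positions. int (t p) * (\<Sum>i=1..n. free_array p (L i)))"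
      unfolding y_def sum.distrib sum_distrib_left by (subst sum.swap) simp
    also have "\<dots> = int (n * free_array_bound * m)" using zero by simp
    finally show ?thesis by (simp only: of_nat_eq_iff)
  qed
  have "x ` ?T \<subseteq> magic_arrays (n * free_array_bound * m)"
  proof clarify
    fix t assume t: "t \<in> ?T"
    have "(\<Sum>i=1..n. x t (v[k := i])) = n * free_array_bound * m" if "v \<in> hc_index d n" "k < d" for v k
      using that axis_balanced_free_array
      by (intro line[OF t]) (auto simp: hc_index_update axis_balanced_def simp del: One_nat_def)
    moreover have "(\<Sum>i=1..n. x t (diag_index d n R i)) = n * free_array_bound * m" if "R \<subseteq> {..<d}" for R
      using that diag_sum_free_array
      by (intro line[OF t]) (auto simp: diag_index_in_hc_index diag_sum_def simp del: One_nat_def)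
    ultimately show "x t \<in> magic_arrays (n * free_array_bound * m)"
      by (auto simp: magic_arrays_def magic_hypercube_def semi_magic_hypercube_def x_def)
  qed
  moreover have "inj_on x ?T"
  proof (rule inj_onI)
    fix t t' assume t: "t \<in> ?T" and t': "t' \<in> ?T" and eq: "x t = x t'"
    have y: "y t v = int (free_array_bound * m) + int (t v)" if "v \<in> free_positions" for t v
    proof -
      have "(\<Sum>p\<in>free_positions. int (t p) * free_array p v)
          = (\<Sum>p\<in>free_positions. if p = v then int (t v) else 0)"
        using that by (intro sum.cong) (auto simp: free_array_on_free)
      then show ?thesis using that finite_free by (simp add: y_def)
    qed
    have "t v = t' v" if "v \<in> free_positions" for v
      using x[OF t, of v] x[OF t', of v] y[OF that, of t] y[OF that, of t'] eq that free_subset by auto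
    then show "t = t'" using t t' by (intro PiE_ext[OF t t'])
  qed
  ultimately have "card ?T \<le> card (magic_arrays (n * free_array_bound * m))"
    using finite_magic_arrays by (metis card_inj_on_le)
  then show ?thesis using finite_free by (simp add: card_PiE)
qed

theorem quasipolynomial_of_degree_magic_arrays:
  "quasipolynomial_of_degree (\<lambda>s. of_nat (card (magic_arrays s))) ((n - 1) ^ d - card K)"
proof (rule quasipolynomial_of_degreeI[where C = 1 and c = 1 and K = "n * free_array_bound"])
  obtain d' where d': "d = Suc d'" using d by (cases d) auto
  show "quasipolynomial (\<lambda>s. of_nat (card (magic_arrays s)))"
    using quasipolynomial_magic_hypercubes[OF n_pos, of d'] by (simp only: magic_arrays_def d'[symmetric])
  show "norm (of_nat (card (magic_arrays s)) :: complex) \<le> 1 * real (s + 1) ^ ((n - 1) ^ d - card K)" for s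
    using card_magic_arrays_le[of s] unfolding card_free norm_of_nat mult_1 of_nat_power[symmetric] of_nat_le_iff .
  show "1 * real m ^ ((n - 1) ^ d - card K)
      \<le> norm (of_nat (card (magic_arrays (n * free_array_bound * m))) :: complex)" for m
    using card_magic_arrays_ge[of m] unfolding card_free norm_of_nat mult_1 of_nat_power[symmetric] of_nat_le_iff .
qed (use n_pos in \<open>auto simp: free_array_bound_def\<close>)

end

section \<open>Cubes of side 3\<close>

text \<open>Replaces sets of reflections by three Booleans, over which the diagonal conditions can
  be enumerated.\<close>

lemma all_subsets_lessThan_3:
  "(\<forall>R\<subseteq>{..<3::nat}. Q (0 \<in> R) (1 \<in> R) (2 \<in> R)) \<longleftrightarrow> (\<forall>p q r. Q p q r)"
proof
  assume Q: "\<forall>R\<subseteq>{..<3::nat}. Q (0 \<in> R) (1 \<in> R) (2 \<in> R)"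
  show "\<forall>p q r. Q p q r"
  proof (intro allI)
    fix p q r
    define R where "R = {k::nat. k = 0 \<and> p \<or> k = 1 \<and> q \<or> k = 2 \<and> r}"
    have "R \<subseteq> {..<3}" by (auto simp: R_def)
    then have "Q (0 \<in> R) (1 \<in> R) (2 \<in> R)" using Q by blast
    then show "Q p q r" by (simp add: R_def)
  qed
qed blast

lemma diag_index_3:
  "diag_index 3 n R i = [if 0 \<in> R then n + 1 - i else i, if 1 \<in> R then n + 1 - i else i,
     if 2 \<in> R then n + 1 - i else i]"
  by (simp add: diag_index_def upt_rec[of _ 3] upt_rec[of _ "Suc (Suc (Suc 0))"] numeral_3_eq_3 numeral_2_eq_2)

lemma hc_index_3_iff: "v \<in> hc_index 3 n \<longleftrightarrow> (\<exists>a\<in>{1..n}. \<exists>b\<in>{1..n}. \<exists>c\<in>{1..n}. v = [a, b, c])"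
  by (auto simp: hc_index_def length_Suc_conv numeral_3_eq_3)

lemma magic_cube_iff:
  "magic_hypercube 3 n s x \<longleftrightarrow>
     (\<forall>v\<in>hc_index 3 n. x v \<ge> 0) \<and>
     (\<forall>a\<in>{1..n}. \<forall>b\<in>{1..n}. (\<Sum>i=1..n. x [i, a, b]) = s \<and> (\<Sum>i=1..n. x [a, i, b]) = s \<and>
        (\<Sum>i=1..n. x [a, b, i]) = s) \<and>
     (\<forall>p q r. (\<Sum>i=1..n. x [if p then n + 1 - i else i, if q then n + 1 - i else i,
        if r then n + 1 - i else i]) = s)"
proof -
  have "(\<forall>v\<in>hc_index 3 n. \<forall>k<3. (\<Sum>i=1..n. x (v[k := i])) = s) \<longleftrightarrow>
      (\<forall>a\<in>{1..n}. \<forall>b\<in>{1..n}. (\<Sum>i=1..n. x [i, a, b]) = s \<and> (\<Sum>i=1..n. x [a, i, b]) = s \<and>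
        (\<Sum>i=1..n. x [a, b, i]) = s)" (is "?l = ?r")
  proof
    assume l: ?l
    show ?r
    proof (intro ballI)
      fix a b assume ab: "a \<in> {1..n}" "b \<in> {1..n}"
      then have "[a, b, b] \<in> hc_index 3 n" "[b, a, b] \<in> hc_index 3 n"
        unfolding hc_index_3_iff by blast+
      then show "(\<Sum>i=1..n. x [i, a, b]) = s \<and> (\<Sum>i=1..n. x [a, i, b]) = s \<and>
        (\<Sum>i=1..n. x [a, b, i]) = s"
        using l[rule_format, of "[b, a, b]" 0] l[rule_format, of "[a, b, b]" 1]
          l[rule_format, of "[a, b, b]" 2] by simp
    qed
  next
    assume r: ?r
    show ?l
    proof (intro ballI allI impI)
      fix v and k :: nat assume v: "v \<in> hc_index 3 n" and k: "k < 3"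
      obtain a b c where abc: "v = [a, b, c]" "a \<in> {1..n}" "b \<in> {1..n}" "c \<in> {1..n}"
        using v unfolding hc_index_3_iff by blast
      consider "k = 0" | "k = 1" | "k = 2" using k by linarith
      then show "(\<Sum>i=1..n. x (v[k := i])) = s"
      proof cases
        case 1
        then show ?thesis using r[rule_format, OF abc(3,4)] abc(1) by simp
      next
        case 2
        then show ?thesis using r[rule_format, OF abc(2,4)] abc(1) by simp
      next
        case 3
        then show ?thesis using r[rule_format, OF abc(2,3)] abc(1) by simp
      qed
    qed
  qed
  moreover have "(\<forall>R\<subseteq>{..<3}. (\<Sum>i=1..n. x (diag_index 3 n R i)) = s) \<longleftrightarrow>
    (\<forall>p q r. (\<Sum>i=1..n. x [if p then n + 1 - i else i, if q then n + 1 - i else i,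
        if r then n + 1 - i else i]) = s)"
    unfolding diag_index_3 by (rule all_subsets_lessThan_3)
  ultimately show ?thesis
    unfolding magic_hypercube_def semi_magic_hypercube_def by simp
qed

lemma sum_1_3: "(\<Sum>i=1..3. f i) = f 1 + f 2 + f (3 :: nat)"
  by (simp add: numeral_3_eq_3 numeral_2_eq_2 sum.atLeast_Suc_atMost add.assoc)

lemma atLeastAtMost_1_3: "{1..3::nat} = {1, 2, 3}"
  by auto

lemma magic_cube_3_iff:
  fixes x :: "nat list \<Rightarrow> nat"
  shows "magic_hypercube 3 3 s x \<longleftrightarrow>
     (\<forall>a\<in>{1, 2, 3}. \<forall>b\<in>{1, 2, 3}. x [1, a, b] + x [2, a, b] + x [3, a, b] = s \<and>
        x [a, 1, b] + x [a, 2, b] + x [a, 3, b] = s \<and> x [a, b, 1] + x [a, b, 2] + x [a, b, 3] = s) \<and>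
     x [1, 1, 1] + x [2, 2, 2] + x [3, 3, 3] = s \<and> x [1, 3, 3] + x [2, 2, 2] + x [3, 1, 1] = s \<and>
     x [3, 1, 3] + x [2, 2, 2] + x [1, 3, 1] = s \<and> x [3, 3, 1] + x [2, 2, 2] + x [1, 1, 3] = s"
proof -
  have diag: "(\<forall>p q r. (\<Sum>i=1..3. x [if p then 3 + 1 - i else i, if q then 3 + 1 - i else i,
        if r then 3 + 1 - i else i]) = s) \<longleftrightarrow>
     x [1, 1, 1] + x [2, 2, 2] + x [3, 3, 3] = s \<and> x [1, 3, 3] + x [2, 2, 2] + x [3, 1, 1] = s \<and>
     x [3, 1, 3] + x [2, 2, 2] + x [1, 3, 1] = s \<and> x [3, 3, 1] + x [2, 2, 2] + x [1, 1, 3] = s"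
    unfolding sum_1_3 all_bool_eq by simp linarith
  show ?thesis
    unfolding magic_cube_iff diag unfolding sum_1_3 unfolding atLeastAtMost_1_3 by (simp only: zero_le ball_triv simp_thms)
qed

text \<open>
  A magic cube of side 3 has centre \<open>m\<close> and magic sum \<open>3 * m\<close>, and opposite entries add up to \<open>2 * m\<close>.
  Its entries, here in lexicographic order of the positions, are determined by the deviations
  \<open>a\<close>, \<open>b\<close>, \<open>c\<close>, \<open>d\<close> from \<open>m\<close> of the corners (1,1,1), (1,3,3), (3,1,3), (3,3,1).
\<close>

definition cube_3_entries :: "int \<Rightarrow> int \<Rightarrow> int \<Rightarrow> int \<Rightarrow> int \<Rightarrow> int list" where
  "cube_3_entries m a b c d =
    [m + a, m - a + d, m - d,
     m - a + c, m + a + b - c - d, m - b + d,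
     m - c, m - b + c, m + b,
     m - a + b, m + a - b + c - d, m - c + d,
     m + a - b - c + d, m, m - a + b + c - d,
     m + c - d, m - a + b - c + d, m + a - b,
     m - b, m + b - c, m + c,
     m + b - d, m - a - b + c + d, m + a - c,
     m + d, m + a - d, m - a]"

definition cube_3 :: "int \<Rightarrow> int \<Rightarrow> int \<Rightarrow> int \<Rightarrow> int \<Rightarrow> nat list \<Rightarrow> nat" where
  "cube_3 m a b c d = restrict (\<lambda>v. nat (cube_3_entries m a b c d !
     (9 * (v ! 0 - 1) + 3 * (v ! 1 - 1) + (v ! 2 - 1)))) (hc_index 3 3)"

definition corner_deviations :: "int \<Rightarrow> (int \<times> int \<times> int \<times> int) set" where
  "corner_deviations m = {(a, b, c, d). (\<forall>e\<in>set (cube_3_entries m a b c d). e \<ge> 0)}"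

lemma hc_index_3_3_in: "a \<in> {1, 2, 3} \<Longrightarrow> b \<in> {1, 2, 3} \<Longrightarrow> c \<in> {1, 2, 3} \<Longrightarrow> [a, b, c] \<in> hc_index 3 3"
  unfolding hc_index_3_iff atLeastAtMost_1_3 by blast

text \<open>With c the centre, a line through it gives s - c for two opposite face centres, two
  lines through these give s + c for four edge midpoints, and four lines through those give 3 * s -
  c for the corners. The diagonals add up to 4 * s = 4 * c + (3 * s - c).\<close>

lemma magic_cube_3_center:
  fixes x :: "nat list \<Rightarrow> nat"
  assumes "magic_hypercube 3 3 s x"
  shows "s = 3 * x [2, 2, 2]"
proof -
  note M = assms[unfolded magic_cube_3_iff]
  have L1: "x [1, a, b] + x [2, a, b] + x [3, a, b] = s" if "a \<in> {1, 2, 3}" "b \<in> {1, 2, 3}" for a b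
    using M that by blast
  have L2: "x [a, 1, b] + x [a, 2, b] + x [a, 3, b] = s" if "a \<in> {1, 2, 3}" "b \<in> {1, 2, 3}" for a b
    using M that by blast
  have L3: "x [a, b, 1] + x [a, b, 2] + x [a, b, 3] = s" if "a \<in> {1, 2, 3}" "b \<in> {1, 2, 3}" for a b
    using M that by blast
  have D: "x [1, 1, 1] + x [2, 2, 2] + x [3, 3, 3] = s" "x [1, 3, 3] + x [2, 2, 2] + x [3, 1, 1] = s"
     "x [3, 1, 3] + x [2, 2, 2] + x [1, 3, 1] = s" "x [3, 3, 1] + x [2, 2, 2] + x [1, 1, 3] = s"
    using M by blast+
  show ?thesis
    using D L1[of 2 2] L2[of 1 2] L2[of 3 2] L3[of 1 1] L3[of 1 3] L3[of 3 1] L3[of 3 3] by simp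
qed

text \<open>Diagonals give the opposite corners; each edge midpoint completes a line with two
  corners, each face centre a line with two edge midpoints.\<close>

lemma magic_cube_3_entries:
  fixes x :: "nat list \<Rightarrow> nat" and m :: nat
  assumes "magic_hypercube 3 3 (3 * m) x"
  defines "a \<equiv> int (x [1, 1, 1]) - int m" and "b \<equiv> int (x [1, 3, 3]) - int m"
    and "c \<equiv> int (x [3, 1, 3]) - int m" and "d \<equiv> int (x [3, 3, 1]) - int m"
  shows "map (\<lambda>v. int (x v)) [[i, j, k]. i \<leftarrow> [1, 2, 3], j \<leftarrow> [1, 2, 3], k \<leftarrow> [1, 2, 3]]
    = cube_3_entries m a b c d"
proof -
  note M = assms(1)[unfolded magic_cube_3_iff]
  have L1: "int (x [1, a, b]) + int (x [2, a, b]) + int (x [3, a, b]) = 3 * int m"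
    if "a \<in> {1, 2, 3}" "b \<in> {1, 2, 3}" for a b
  proof -
    have "x [1, a, b] + x [2, a, b] + x [3, a, b] = 3 * m" using M that by blast
    then show ?thesis by linarith
  qed
  have L2: "int (x [a, 1, b]) + int (x [a, 2, b]) + int (x [a, 3, b]) = 3 * int m"
    if "a \<in> {1, 2, 3}" "b \<in> {1, 2, 3}" for a b
  proof -
    have "x [a, 1, b] + x [a, 2, b] + x [a, 3, b] = 3 * m" using M that by blast
    then show ?thesis by linarith
  qed
  have L3: "int (x [a, b, 1]) + int (x [a, b, 2]) + int (x [a, b, 3]) = 3 * int m"
    if "a \<in> {1, 2, 3}" "b \<in> {1, 2, 3}" for a b
  proof -
    have "x [a, b, 1] + x [a, b, 2] + x [a, b, 3] = 3 * m" using M that by blast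
    then show ?thesis by linarith
  qed
  have D: "x [1, 1, 1] + x [2, 2, 2] + x [3, 3, 3] = 3 * m" "x [1, 3, 3] + x [2, 2, 2] + x [3, 1, 1] = 3 * m"
     "x [3, 1, 3] + x [2, 2, 2] + x [1, 3, 1] = 3 * m" "x [3, 3, 1] + x [2, 2, 2] + x [1, 1, 3] = 3 * m"
    using M by blast+
  have center: "int (x [2, 2, 2]) = int m" using magic_cube_3_center[OF assms(1)] by simp
  have corners: "int (x [1, 1, 1]) = int m + a" "int (x [3, 3, 3]) = int m - a" "int (x [1, 3, 3]) = int m + b"
    "int (x [3, 1, 1]) = int m - b" "int (x [3, 1, 3]) = int m + c" "int (x [1, 3, 1]) = int m - c"
    "int (x [3, 3, 1]) = int m + d" "int (x [1, 1, 3]) = int m - d"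
    using D center unfolding a_def b_def c_def d_def by linarith+
  have edges3: "int (x [1, 1, 2]) = int m - a + d" "int (x [1, 3, 2]) = int m - b + c"
     "int (x [3, 1, 2]) = int m + b - c" "int (x [3, 3, 2]) = int m + a - d"
    using L3[of 1 1] L3[of 1 3] L3[of 3 1] L3[of 3 3] corners by simp_all
  have edges2: "int (x [1, 2, 1]) = int m - a + c" "int (x [1, 2, 3]) = int m - b + d"
     "int (x [3, 2, 1]) = int m + b - d" "int (x [3, 2, 3]) = int m + a - c"
    using L2[of 1 1] L2[of 1 3] L2[of 3 1] L2[of 3 3] corners by simp_all
  have edges1: "int (x [2, 1, 1]) = int m - a + b" "int (x [2, 1, 3]) = int m - c + d"
     "int (x [2, 3, 1]) = int m + c - d" "int (x [2, 3, 3]) = int m + a - b"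
    using L1[of 1 1] L1[of 1 3] L1[of 3 1] L1[of 3 3] corners by simp_all
  have faces: "int (x [1, 2, 2]) = int m + a + b - c - d" "int (x [2, 1, 2]) = int m + a - b + c - d"
     "int (x [2, 2, 1]) = int m + a - b - c + d" "int (x [3, 2, 2]) = int m - a - b + c + d"
     "int (x [2, 3, 2]) = int m - a + b - c + d" "int (x [2, 2, 3]) = int m - a + b + c - d"
    using L3[of 1 2] L3[of 2 1] L2[of 2 1] L3[of 3 2] L3[of 2 3] L2[of 2 3] edges1 edges2 edges3 by simp_all
  show ?thesis
    unfolding cube_3_entries_def by (simp add: corners edges1 edges2 edges3 faces center del: One_nat_def)
qed

lemma cube_3_apply:
  assumes "(a, b, c, d) \<in> corner_deviations m" "i \<in> {1, 2, 3}" "j \<in> {1, 2, 3}" "k \<in> {1, 2, 3}"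
  shows "int (cube_3 m a b c d [i, j, k])
    = cube_3_entries m a b c d ! (9 * (i - 1) + 3 * (j - 1) + (k - 1))"
proof -
  have "9 * (i - 1) + 3 * (j - 1) + (k - 1) < length (cube_3_entries m a b c d)"
    using assms(2-4) by (auto simp: cube_3_entries_def)
  then have "cube_3_entries m a b c d ! (9 * (i - 1) + 3 * (j - 1) + (k - 1))
      \<in> set (cube_3_entries m a b c d)" by (rule nth_mem)
  then show ?thesis
    using assms hc_index_3_3_in[OF assms(2-4)] by (auto simp: cube_3_def corner_deviations_def)
qed

lemma magic_cube_3_cube_3:
  assumes "(a, b, c, d) \<in> corner_deviations (int m)"
  shows "magic_hypercube 3 3 (3 * m) (cube_3 (int m) a b c d)"
proof -
  have A: "int (cube_3 m a b c d [i, j, k]) = cube_3_entries m a b c d ! (9 * (i - 1) + 3 * (j - 1) + (k - 1))"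
    if "i \<in> {1, 2, 3}" "j \<in> {1, 2, 3}" "k \<in> {1, 2, 3}" for i j k
    using cube_3_apply[OF assms] that by blast
  have eq: "p + q + r = 3 * m \<longleftrightarrow> int p + int q + int r = 3 * int m" for p q r by linarith
  show ?thesis
    unfolding magic_cube_3_iff eq by (simp add: A del: One_nat_def) (simp add: cube_3_entries_def)
qed

lemma MC_3_multiple: "MC 3 (3 * m) = card (corner_deviations (int m))"
proof -
  let ?f = "\<lambda>x. (int (x [1, 1, 1]) - int m, int (x [1, 3, 3]) - int m,
    int (x [3, 1, 3]) - int m, int (x [3, 3, 1]) - int m)"
  let ?g = "\<lambda>(a, b, c, d). cube_3 (int m) a b c d"
  let ?X = "{x :: nat list \<Rightarrow> nat. x \<in> extensional (hc_index 3 3) \<and> magic_hypercube 3 3 (3 * m) x}"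
  have "bij_betw ?f ?X (corner_deviations (int m))"
  proof (rule bij_betw_byWitness[where f' = ?g])
    show in_dev: "?f ` ?X \<subseteq> corner_deviations (int m)"
    proof
      fix e assume "e \<in> ?f ` ?X"
      then obtain x where x: "magic_hypercube 3 3 (3 * m) x" "e = ?f x" by auto
      show "e \<in> corner_deviations (int m)"
        unfolding x(2) corner_deviations_def mem_Collect_eq case_prod_conv
          magic_cube_3_entries[OF x(1), symmetric] by auto
    qed
    show "?g ` corner_deviations (int m) \<subseteq> ?X"
      using magic_cube_3_cube_3 by (auto simp: cube_3_def)
    show "\<forall>e\<in>corner_deviations (int m). ?f (?g e) = e"
    proof
      fix e assume e: "e \<in> corner_deviations (int m)"
      obtain a b c d where abcd: "e = (a, b, c, d)" by (rule prod_cases4)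
      from cube_3_apply[OF e[unfolded abcd]] show "?f (?g e) = e"
        unfolding abcd by (simp del: One_nat_def) (simp add: cube_3_entries_def)
    qed
    show "\<forall>x\<in>?X. ?g (?f x) = x"
    proof
      fix x assume x: "x \<in> ?X"
      obtain a b c d where e: "?f x = (a, b, c, d)" by (metis prod_cases4)
      have dev: "(a, b, c, d) \<in> corner_deviations (int m)" using in_dev x e by blast
      have "cube_3 (int m) a b c d = x"
      proof (rule extensionalityI[of _ "hc_index 3 3"])
        fix v assume "v \<in> hc_index 3 3"
        then obtain i j k where v: "v = [i, j, k]" and ijk: "i \<in> {1, 2, 3}" "j \<in> {1, 2, 3}" "k \<in> {1, 2, 3}"
          unfolding hc_index_3_iff atLeastAtMost_1_3 by blast
        have "cube_3_entries m a b c d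
            = map (\<lambda>v. int (x v)) [[i, j, k]. i \<leftarrow> [1, 2, 3], j \<leftarrow> [1, 2, 3], k \<leftarrow> [1, 2, 3]]"
          using magic_cube_3_entries[of m x] x e by simp
        then have "int (cube_3 m a b c d v) = int (x v)"
          using cube_3_apply[OF dev ijk] ijk unfolding v by auto
        then show "cube_3 (int m) a b c d v = x v" by simp
      qed (use x in \<open>auto simp: cube_3_def\<close>)
      then show "?g (?f x) = x" unfolding e by simp
    qed
  qed
  then show ?thesis unfolding MC_def by (rule bij_betw_same_card)
qed

lemma MC_3_not_multiple:
  assumes "\<not> 3 dvd s"
  shows "MC 3 s = 0"
proof -
  have "{x :: nat list \<Rightarrow> nat. x \<in> extensional (hc_index 3 3) \<and> magic_hypercube 3 3 s x} = {}"
    using magic_cube_3_center assms by fastforce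
  then show ?thesis unfolding MC_def by (simp only: card.empty)
qed

text \<open>
  In the coordinates \<open>u = a + b - c - d\<close>, \<open>v = a + c - b - d\<close>, \<open>w = a + d - b - c\<close> of equal parity, all
  conditions but those on the corners say that \<open>u\<close>, \<open>v\<close>, \<open>w\<close> are at most \<open>m\<close> in absolute value, and the
  corners leave an interval for \<open>a\<close> whose length depends only on the two largest of these values.
\<close>

definition two_largest :: "int \<Rightarrow> int \<Rightarrow> int \<Rightarrow> int" where
  "two_largest x y z = x + y + z - min x (min y z)"

definition parity_triples :: "int \<Rightarrow> (int \<times> int \<times> int) set" where
  "parity_triples m = {(u, v, w). \<bar>u\<bar> \<le> m \<and> \<bar>v\<bar> \<le> m \<and> \<bar>w\<bar> \<le> m \<and> even (u + v) \<and> even (u + w)}"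

text \<open>Since v + w = 2 * (a - b) and similarly for c and d, the four bounds are those on the
  four corner deviations.\<close>

definition shift_range :: "int \<Rightarrow> int \<times> int \<times> int \<Rightarrow> int set" where
  "shift_range m = (\<lambda>(u, v, w). {a. \<bar>a\<bar> \<le> m \<and> \<bar>a - (v + w) div 2\<bar> \<le> m \<and> \<bar>a - (u + w) div 2\<bar> \<le> m
     \<and> \<bar>a - (u + v) div 2\<bar> \<le> m})"

lemma two_largest_eq_max: "two_largest x y z = max (y + z) (max (x + z) (x + y))"
  by (auto simp: two_largest_def max_def min_def)

text \<open>\<open>hi - lo\<close> is the largest difference among 0, p, q, r. The six doubled
  differences are, up to sign, the sums and differences of two of u, v, w, and the larger of \<bar>s
  + t\<bar> and \<bar>s - t\<bar> is \<bar>s\<bar> + \<bar>t\<bar>.\<close>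

lemma spread_eq_two_largest:
  fixes p q r u v w :: int
  assumes pqr: "2 * p = v + w" "2 * q = u + w" "2 * r = u + v"
  defines "hi \<equiv> max (max 0 p) (max q r)" and "lo \<equiv> min (min 0 p) (min q r)"
  shows "2 * (hi - lo) = two_largest \<bar>u\<bar> \<bar>v\<bar> \<bar>w\<bar>"
proof (rule antisym)
  have abs: "\<bar>s\<bar> + \<bar>t\<bar> \<le> y \<longleftrightarrow> s + t \<le> y \<and> s - t \<le> y \<and> t - s \<le> y \<and> - s - t \<le> y" for s t y :: int
    by linarith
  have hi: "0 \<le> hi" "p \<le> hi" "q \<le> hi" "r \<le> hi" by (simp_all add: hi_def)
  have lo: "lo \<le> 0" "lo \<le> p" "lo \<le> q" "lo \<le> r" by (simp_all add: lo_def)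
  have "\<bar>v\<bar> + \<bar>w\<bar> \<le> 2 * (hi - lo) \<and> \<bar>u\<bar> + \<bar>w\<bar> \<le> 2 * (hi - lo) \<and> \<bar>u\<bar> + \<bar>v\<bar> \<le> 2 * (hi - lo)"
    unfolding abs using pqr hi lo by (intro conjI) simp_all
  then show "two_largest \<bar>u\<bar> \<bar>v\<bar> \<bar>w\<bar> \<le> 2 * (hi - lo)" by (simp add: two_largest_eq_max)
  define x where "x = two_largest \<bar>u\<bar> \<bar>v\<bar> \<bar>w\<bar>"
  have x: "\<bar>v\<bar> + \<bar>w\<bar> \<le> x" "\<bar>u\<bar> + \<bar>w\<bar> \<le> x" "\<bar>u\<bar> + \<bar>v\<bar> \<le> x"
    by (simp_all add: x_def two_largest_eq_max le_max_iff_disj)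
  have x': "s + t \<le> x" "s - t \<le> x" "t - s \<le> x" "- s - t \<le> x" "0 \<le> x"
    if "(s, t) \<in> {(v, w), (u, w), (u, v)}" for s t using x that by auto
  have "hi = 0 \<or> hi = p \<or> hi = q \<or> hi = r" by (auto simp: hi_def max_def)
  moreover have "lo = 0 \<or> lo = p \<or> lo = q \<or> lo = r" by (auto simp: lo_def min_def)
  ultimately show "2 * (hi - lo) \<le> two_largest \<bar>u\<bar> \<bar>v\<bar> \<bar>w\<bar>"
    unfolding x_def[symmetric] using pqr x'[of v w] x'[of u w] x'[of u v]
    by (elim disjE) simp_all
qed

text \<open>The range is an interval with 2 * m + 1 - (hi - lo) elements; the bounds on u, v, w give
  hi - lo \<le> m, so this number is positive.\<close>

lemma card_shift_range:
  assumes "(u, v, w) \<in> parity_triples m"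
  shows "2 * int (card (shift_range m (u, v, w))) = 4 * m + 2 - two_largest \<bar>u\<bar> \<bar>v\<bar> \<bar>w\<bar>"
proof -
  define p q r where "p = (v + w) div 2" and "q = (u + w) div 2" and "r = (u + v) div 2"
  define hi lo where "hi = max (max 0 p) (max q r)" and "lo = min (min 0 p) (min q r)"
  have parity: "even (u + v)" "even (u + w)" and bounds: "\<bar>u\<bar> \<le> m" "\<bar>v\<bar> \<le> m" "\<bar>w\<bar> \<le> m"
    using assms by (auto simp: parity_triples_def)
  then have "even (v + w)" by presburger
  then have "2 * p = v + w" "2 * q = u + w" "2 * r = u + v"
    using parity by (auto simp: p_def q_def r_def)
  then have spread: "2 * (hi - lo) = two_largest \<bar>u\<bar> \<bar>v\<bar> \<bar>w\<bar>"
    unfolding hi_def lo_def by (rule spread_eq_two_largest)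
  moreover have "two_largest \<bar>u\<bar> \<bar>v\<bar> \<bar>w\<bar> \<le> 2 * m"
    using bounds by (simp add: two_largest_eq_max)
  moreover have "shift_range m (u, v, w) = {hi - m..lo + m}"
  proof -
    have "hi \<le> a + m \<longleftrightarrow> 0 \<le> a + m \<and> p \<le> a + m \<and> q \<le> a + m \<and> r \<le> a + m"
      "a - m \<le> lo \<longleftrightarrow> a - m \<le> 0 \<and> a - m \<le> p \<and> a - m \<le> q \<and> a - m \<le> r" for a
      by (simp_all add: hi_def lo_def)
    moreover have "shift_range m (u, v, w) = {a. \<bar>a\<bar> \<le> m \<and> \<bar>a - p\<bar> \<le> m \<and> \<bar>a - q\<bar> \<le> m \<and> \<bar>a - r\<bar> \<le> m}"
      by (simp add: shift_range_def p_def q_def r_def)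
    moreover have "{hi - m..lo + m} = {a. hi \<le> a + m \<and> a - m \<le> lo}" by auto
    moreover have "\<bar>a\<bar> \<le> m \<and> \<bar>a - p\<bar> \<le> m \<and> \<bar>a - q\<bar> \<le> m \<and> \<bar>a - r\<bar> \<le> m \<longleftrightarrow>
        (0 \<le> a + m \<and> p \<le> a + m \<and> q \<le> a + m \<and> r \<le> a + m) \<and>
        (a - m \<le> 0 \<and> a - m \<le> p \<and> a - m \<le> q \<and> a - m \<le> r)" for a by linarith
    ultimately show ?thesis by simp
  qed
  ultimately show ?thesis using bounds by auto
qed

text \<open>Antipodal entries are m + t and m - t, so the 26 outer entries give thirteen absolute
  values; m \<ge> 0 at the centre follows from \<bar>a\<bar> \<le> m.\<close>

lemma corner_deviations_iff:
  "(a, b, c, d) \<in> corner_deviations m \<longleftrightarrow>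
     \<bar>a\<bar> \<le> m \<and> \<bar>b\<bar> \<le> m \<and> \<bar>c\<bar> \<le> m \<and> \<bar>d\<bar> \<le> m \<and>
     \<bar>a - b\<bar> \<le> m \<and> \<bar>a - c\<bar> \<le> m \<and> \<bar>a - d\<bar> \<le> m \<and> \<bar>b - c\<bar> \<le> m \<and> \<bar>b - d\<bar> \<le> m \<and> \<bar>c - d\<bar> \<le> m \<and>
     \<bar>a + b - c - d\<bar> \<le> m \<and> \<bar>a + c - b - d\<bar> \<le> m \<and> \<bar>a + d - b - c\<bar> \<le> m"
  unfolding corner_deviations_def cube_3_entries_def by (simp add: abs_le_iff) linarith

text \<open>For the inverse map, the edge conditions follow from the bounds on u, v, w: the
  differences of a, b, c, d are half sums or half differences of two of these, up to sign. Equal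
  parity makes the halves integers.\<close>

lemma bij_betw_corner_deviations:
  "bij_betw (\<lambda>(a, b, c, d). ((a + b - c - d, a + c - b - d, a + d - b - c), a))
     (corner_deviations m) (SIGMA t:parity_triples m. shift_range m t)"
proof (rule bij_betw_byWitness[where f' =
    "\<lambda>((u, v, w), a). (a, a - (v + w) div 2, a - (u + w) div 2, a - (u + v) div 2)"])
  let ?f = "\<lambda>(a, b, c, d). ((a + b - c - d, a + c - b - d, a + d - b - c), a)"
  let ?g = "\<lambda>((u, v, w), a). (a, a - (v + w) div 2, a - (u + w) div 2, a - (u + v) div 2) :: int \<times> int \<times> int \<times> int"
  have half: "(a + c - b - d + (a + d - b - c)) div 2 = a - b" "(a + b - c - d + (a + d - b - c)) div 2 = a - c"
    "(a + b - c - d + (a + c - b - d)) div 2 = a - d" for a b c d :: int by presburger+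
  show "\<forall>e\<in>corner_deviations m. ?g (?f e) = e"
    by (auto simp: half)
  show "?f ` corner_deviations m \<subseteq> (SIGMA t:parity_triples m. shift_range m t)"
  proof clarify
    fix a b c d assume e: "(a, b, c, d) \<in> corner_deviations m"
    have "even (a + b - c - d + (a + c - b - d))" "even (a + b - c - d + (a + d - b - c))"
      by presburger+
    then show "(a + b - c - d, a + c - b - d, a + d - b - c) \<in> parity_triples m \<and>
        a \<in> shift_range m (a + b - c - d, a + c - b - d, a + d - b - c)"
      using e unfolding corner_deviations_iff parity_triples_def shift_range_def mem_Collect_eq case_prod_conv half
      by simp
  qed
  have halves: "\<exists>p q r. v + w = 2 * p \<and> u + w = 2 * q \<and> u + v = 2 * r"
    if "(u, v, w) \<in> parity_triples m" for u v w
  proof -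
    have "even (u + v)" "even (u + w)" using that by (auto simp: parity_triples_def)
    moreover from this have "even (v + w)" by presburger
    ultimately show ?thesis
      by (intro exI[of _ "(v + w) div 2"] exI[of _ "(u + w) div 2"] exI[of _ "(u + v) div 2"]) simp
  qed
  show "\<forall>t\<in>SIGMA t:parity_triples m. shift_range m t. ?f (?g t) = t"
  proof
    fix t assume t: "t \<in> (SIGMA t:parity_triples m. shift_range m t)"
    obtain u v w a where uvwa: "t = ((u, v, w), a)" by (metis prod.collapse)
    then have "(u, v, w) \<in> parity_triples m" using t by simp
    then obtain p q r where "v + w = 2 * p" "u + w = 2 * q" "u + v = 2 * r" using halves by blast
    then show "?f (?g t) = t" unfolding uvwa by simp
  qed
  show "?g ` (SIGMA t:parity_triples m. shift_range m t) \<subseteq> corner_deviations m"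
  proof clarify
    fix u v w a assume t: "(u, v, w) \<in> parity_triples m" and a: "a \<in> shift_range m (u, v, w)"
    obtain p q r where pqr: "v + w = 2 * p" "u + w = 2 * q" "u + v = 2 * r" using halves[OF t] by blast
    have "(a, a - p, a - q, a - r) \<in> corner_deviations m"
      unfolding corner_deviations_iff
      using t a pqr unfolding shift_range_def parity_triples_def mem_Collect_eq case_prod_conv abs_le_iff
      by (intro conjI) (simp, linarith)+
    then show "(a, a - (v + w) div 2, a - (u + w) div 2, a - (u + v) div 2) \<in> corner_deviations m"
      using pqr by simp
  qed
qed

section \<open>Sums over triples of equal parity\<close>

definition parity_range :: "nat \<Rightarrow> int set" where
  "parity_range k = {u. \<bar>u\<bar> \<le> int k \<and> even (u - int k)}"

lemma finite_parity_range: "finite (parity_range k)"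
  by (rule finite_subset[of _ "{- int k..int k}"]) (auto simp: parity_range_def)

lemma parity_range_0: "parity_range 0 = {0}"
  by (auto simp: parity_range_def)

lemma parity_range_1: "parity_range (Suc 0) = {1, - 1}"
proof -
  have "u = 1 \<or> u = - 1" if "\<bar>u\<bar> \<le> 1" "even (u - 1)" for u :: int using that by presburger
  then show ?thesis by (auto simp: parity_range_def)
qed

lemma parity_range_Suc_Suc:
  "parity_range (Suc (Suc k)) = insert (int k + 2) (insert (- (int k + 2)) (parity_range k))"
proof -
  have "\<bar>u\<bar> \<le> int k + 2 \<and> even (u - (int k + 2)) \<longleftrightarrow>
      u = int k + 2 \<or> u = - (int k + 2) \<or> \<bar>u\<bar> \<le> int k \<and> even (u - int k)" for u by presburger
  then show ?thesis by (auto simp: parity_range_def add.commute)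
qed

lemma sum_parity_range_Suc_Suc:
  "(\<Sum>u\<in>parity_range (Suc (Suc k)). f u) = f (int k + 2) + (f (- (int k + 2)) + (\<Sum>u\<in>parity_range k. f u))"
proof -
  have "int k + 2 \<notin> parity_range k" "- (int k + 2) \<notin> parity_range k" by (auto simp: parity_range_def)
  then show ?thesis unfolding parity_range_Suc_Suc using finite_parity_range by simp
qed

text \<open>From k to k + 2 only the values k + 2 and -(k + 2) are new, so sums over Cartesian
  powers of parity ranges grow by one shell.\<close>

lemma parity_range_induct [case_names 0 1 step]:
  assumes "P 0" "P (Suc 0)" "\<And>k. P k \<Longrightarrow> P (Suc (Suc k))"
  shows "P (k :: nat)"
  using assms by (induction k rule: induct_nat_012) auto

lemma card_parity_range: "card (parity_range k) = k + 1"
proof (induction k rule: parity_range_induct)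
  case (step k)
  have "int k + 2 \<notin> parity_range k" "- (int k + 2) \<notin> parity_range k" by (auto simp: parity_range_def)
  then show ?case
    using step finite_parity_range by (simp add: parity_range_Suc_Suc)
qed (simp_all add: parity_range_0 parity_range_1)

lemma sum_max_parity_range:
  "3 * (\<Sum>v\<in>parity_range k. \<Sum>w\<in>parity_range k. max \<bar>v\<bar> \<bar>w\<bar>) = 2 * int k * (int k + 1) * (int k + 2)"
proof (induction k rule: parity_range_induct)
  case (step k)
  define h where "h = int k + 2"
  have h: "\<bar>h\<bar> = h" by (simp add: h_def)
  have "max h \<bar>w\<bar> = h" "max \<bar>w\<bar> h = h" if "w \<in> parity_range k" for w
    using that by (auto simp: parity_range_def h_def)
  \<comment> \<open>The shell has 4 * (k + 1) pairs with one coordinate of absolute value h and 4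
    pairs with two; each contributes h.\<close>
  then have "(\<Sum>v\<in>parity_range (Suc (Suc k)). \<Sum>w\<in>parity_range (Suc (Suc k)). max \<bar>v\<bar> \<bar>w\<bar>)
      = (\<Sum>v\<in>parity_range k. \<Sum>w\<in>parity_range k. max \<bar>v\<bar> \<bar>w\<bar>) + 4 * (int k + 1) * h + 4 * h"
    unfolding sum_parity_range_Suc_Suc h_def[symmetric]
    by (simp add: h sum.distrib card_parity_range algebra_simps cong: sum.cong)
  then show ?case using step by (simp add: h_def algebra_simps)
qed (simp_all add: parity_range_0 parity_range_1)

lemma sum_two_largest_parity_range:
  "4 * (\<Sum>u\<in>parity_range k. \<Sum>v\<in>parity_range k. \<Sum>w\<in>parity_range k. two_largest \<bar>u\<bar> \<bar>v\<bar> \<bar>w\<bar>)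
    = 5 * int k ^ 4 + 20 * int k ^ 3 + 26 * int k ^ 2 + 12 * int k + of_bool (odd k)"
proof (induction k rule: parity_range_induct)
  case (step k)
  define h where "h = int k + 2"
  have h: "\<bar>h\<bar> = h" by (simp add: h_def)
  have le: "\<bar>w\<bar> \<le> h" if "w \<in> parity_range k" for w
    using that by (auto simp: parity_range_def h_def)
  have one: "two_largest h \<bar>v\<bar> \<bar>w\<bar> = h + max \<bar>v\<bar> \<bar>w\<bar>" "two_largest \<bar>v\<bar> h \<bar>w\<bar> = h + max \<bar>v\<bar> \<bar>w\<bar>"
    "two_largest \<bar>v\<bar> \<bar>w\<bar> h = h + max \<bar>v\<bar> \<bar>w\<bar>"
    if "v \<in> parity_range k" "w \<in> parity_range k" for v w
    using le[OF that(1)] le[OF that(2)] by (auto simp: two_largest_eq_max max_def)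
  have two: "two_largest h h \<bar>w\<bar> = 2 * h" "two_largest h \<bar>w\<bar> h = 2 * h" "two_largest \<bar>w\<bar> h h = 2 * h"
    if "w \<in> parity_range k" for w
    using le[OF that] by (auto simp: two_largest_def)
  have three: "two_largest h h h = 2 * h" by (simp add: two_largest_def)
  let ?S = "\<Sum>u\<in>parity_range k. \<Sum>v\<in>parity_range k. \<Sum>w\<in>parity_range k. two_largest \<bar>u\<bar> \<bar>v\<bar> \<bar>w\<bar>"
  let ?M = "\<Sum>v\<in>parity_range k. \<Sum>w\<in>parity_range k. max \<bar>v\<bar> \<bar>w\<bar>"
  \<comment> \<open>In the shell, 6 * (k + 1) ^ 2 triples have one coordinate of absolute value h
    and contribute h plus the maximum of the rest; 12 * (k + 1) triples with two and 8 with three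
    contribute 2 * h each.\<close>
  have "(\<Sum>u\<in>parity_range (Suc (Suc k)). \<Sum>v\<in>parity_range (Suc (Suc k)). \<Sum>w\<in>parity_range (Suc (Suc k)).
        two_largest \<bar>u\<bar> \<bar>v\<bar> \<bar>w\<bar>)
      = ?S + 6 * ((int k + 1) ^ 2 * h + ?M) + 24 * (int k + 1) * h + 16 * h"
    unfolding sum_parity_range_Suc_Suc h_def[symmetric]
    by (simp add: h one two three sum.distrib card_parity_range algebra_simps power2_eq_square cong: sum.cong)
       (simp add: sum_distrib_left[symmetric])
  then show ?case using step sum_max_parity_range[of k]
    by (simp add: h_def algebra_simps power2_eq_square power3_eq_cube power4_eq_xxxx)
qed (simp_all add: parity_range_0 parity_range_1 two_largest_def)

text \<open>Three integers of equal parity all have the parity of n + 1 or all that of n; in the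
  second case n + 1 itself is not attained.\<close>

lemma parity_triples_Suc:
  "parity_triples (int (Suc n)) =
     parity_range (Suc n) \<times> parity_range (Suc n) \<times> parity_range (Suc n) \<union>
     parity_range n \<times> parity_range n \<times> parity_range n"
proof -
  have range: "\<bar>u\<bar> \<le> int (Suc n) \<longleftrightarrow> u \<in> parity_range (Suc n) \<or> u \<in> parity_range n" for u
    unfolding parity_range_def mem_Collect_eq of_nat_Suc by presburger
  have parity: "even (u + v) \<longleftrightarrow> (u \<in> parity_range (Suc n) \<longleftrightarrow> v \<in> parity_range (Suc n))"
    "u \<in> parity_range (Suc n) \<Longrightarrow> u \<notin> parity_range n"
    if "u \<in> parity_range (Suc n) \<or> u \<in> parity_range n" "v \<in> parity_range (Suc n) \<or> v \<in> parity_range n" for u v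
    using that unfolding parity_range_def mem_Collect_eq of_nat_Suc by presburger+
  show ?thesis
    unfolding parity_triples_def range using parity by blast
qed

lemma sum_parity_triples_Suc:
  "(\<Sum>(u, v, w)\<in>parity_triples (int (Suc n)). f u v w)
    = (\<Sum>u\<in>parity_range (Suc n). \<Sum>v\<in>parity_range (Suc n). \<Sum>w\<in>parity_range (Suc n). f u v w)
    + (\<Sum>u\<in>parity_range n. \<Sum>v\<in>parity_range n. \<Sum>w\<in>parity_range n. f u v w)"
proof -
  have disjoint: "parity_range (Suc n) \<inter> parity_range n = {}"
  proof -
    have "\<not> (even (u - (1 + int n)) \<and> even (u - int n))" for u by presburger
    then show ?thesis by (auto simp: parity_range_def)
  qed
  show ?thesis
    unfolding parity_triples_Suc
    by (subst sum.union_disjoint) (use disjoint in \<open>auto simp: finite_parity_range sum.cartesian_product\<close>)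
qed

lemma card_corner_deviations:
  "4 * card (corner_deviations (int m)) = 11 * m ^ 4 + 22 * m ^ 3 + 25 * m ^ 2 + 14 * m + 4"
proof -
  have fin: "finite (parity_triples (int m))"
  proof (rule finite_subset)
    show "parity_triples (int m) \<subseteq> {- int m..int m} \<times> {- int m..int m} \<times> {- int m..int m}"
    proof
      fix t assume t: "t \<in> parity_triples (int m)"
      obtain u v w where uvw: "t = (u, v, w)" by (rule prod_cases3)
      have "\<bar>u\<bar> \<le> int m" "\<bar>v\<bar> \<le> int m" "\<bar>w\<bar> \<le> int m"
        using t unfolding uvw parity_triples_def mem_Collect_eq case_prod_conv by blast+
      then show "t \<in> {- int m..int m} \<times> {- int m..int m} \<times> {- int m..int m}"
        unfolding uvw abs_le_iff by (simp add: minus_le_iff)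
    qed
  qed simp
  have fin': "finite (shift_range (int m) t)" for t
  proof (rule finite_subset)
    have "shift_range (int m) t \<subseteq> {a. \<bar>a\<bar> \<le> int m}" unfolding shift_range_def case_prod_beta by blast
    also have "\<dots> = {- int m..int m}" by auto
    finally show "shift_range (int m) t \<subseteq> {- int m..int m}" .
  qed simp
  have "card (corner_deviations (int m)) = (\<Sum>t\<in>parity_triples (int m). card (shift_range (int m) t))"
    using bij_betw_same_card[OF bij_betw_corner_deviations[of "int m"]] fin fin' by simp
  then have "2 * int (card (corner_deviations (int m)))
      = (\<Sum>t\<in>parity_triples (int m). 2 * int (card (shift_range (int m) t)))"
    by (simp add: sum_distrib_left)
  also have "\<dots> = (\<Sum>(u, v, w)\<in>parity_triples (int m). 4 * int m + 2 - two_largest \<bar>u\<bar> \<bar>v\<bar> \<bar>w\<bar>)"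
    by (intro sum.cong refl) (auto simp: card_shift_range)
  finally have sum: "2 * int (card (corner_deviations (int m)))
      = (\<Sum>(u, v, w)\<in>parity_triples (int m). 4 * int m + 2 - two_largest \<bar>u\<bar> \<bar>v\<bar> \<bar>w\<bar>)" .
  have "8 * int (card (corner_deviations (int m)))
      = 2 * (11 * int m ^ 4 + 22 * int m ^ 3 + 25 * int m ^ 2 + 14 * int m + 4)"
  proof (cases m)
    case 0
    have "parity_triples 0 = {(0, 0, 0)}" by (auto simp: parity_triples_def)
    then show ?thesis using sum 0 by (simp add: two_largest_def)
  next
    case (Suc n)
    have T: "(\<Sum>u\<in>parity_range k. \<Sum>v\<in>parity_range k. \<Sum>w\<in>parity_range k. x - two_largest \<bar>u\<bar> \<bar>v\<bar> \<bar>w\<bar>)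
      = (int k + 1) ^ 3 * x
        - (\<Sum>u\<in>parity_range k. \<Sum>v\<in>parity_range k. \<Sum>w\<in>parity_range k. two_largest \<bar>u\<bar> \<bar>v\<bar> \<bar>w\<bar>)" for k x
      by (simp add: sum_subtractf card_parity_range power3_eq_cube algebra_simps)
    define A B where
      "A = (\<Sum>u\<in>parity_range (Suc n). \<Sum>v\<in>parity_range (Suc n). \<Sum>w\<in>parity_range (Suc n). two_largest \<bar>u\<bar> \<bar>v\<bar> \<bar>w\<bar>)"
      and "B = (\<Sum>u\<in>parity_range n. \<Sum>v\<in>parity_range n. \<Sum>w\<in>parity_range n. two_largest \<bar>u\<bar> \<bar>v\<bar> \<bar>w\<bar>)"
    have "2 * int (card (corner_deviations (int m)))
      = ((int (Suc n) + 1) ^ 3 * (4 * int m + 2) - A) + ((int n + 1) ^ 3 * (4 * int m + 2) - B)"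
      unfolding sum unfolding Suc sum_parity_triples_Suc T A_def B_def ..
    \<comment> \<open>Exactly one of n and n + 1 is odd, so the parity terms add up to 1 and the
      count is a polynomial in m.\<close>
    moreover have "4 * A + 4 * B = 5 * int (Suc n) ^ 4 + 20 * int (Suc n) ^ 3 + 26 * int (Suc n) ^ 2 + 12 * int (Suc n)
        + (5 * int n ^ 4 + 20 * int n ^ 3 + 26 * int n ^ 2 + 12 * int n) + 1"
      unfolding A_def B_def sum_two_largest_parity_range by simp
    ultimately show ?thesis
      by (simp add: Suc algebra_simps power2_eq_square power3_eq_cube power4_eq_xxxx)
  qed
  then have "int (4 * card (corner_deviations (int m))) = int (11 * m ^ 4 + 22 * m ^ 3 + 25 * m ^ 2 + 14 * m + 4)"
    by simp
  then show ?thesis by (simp only: of_nat_eq_iff)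
qed

lemma MC_3_formula:
  "real (MC 3 s) = (if 3 dvd s
     then 11 / 324 * real s ^ 4 + 11 / 54 * real s ^ 3 + 25 / 36 * real s ^ 2 + 7 / 6 * real s + 1 else 0)"
proof (cases "3 dvd s")
  case True
  then obtain m where s: "s = 3 * m" by auto
  have "real (4 * MC 3 s) = real (11 * m ^ 4 + 22 * m ^ 3 + 25 * m ^ 2 + 14 * m + 4)"
    unfolding s MC_3_multiple card_corner_deviations ..
  then show ?thesis using True by (simp add: s power_mult_distrib field_simps)
qed (simp add: MC_3_not_multiple)

section \<open>Degree and generating function\<close>

lemma box_array_3:
  "box_array 3 [r0, r1, r2] [p0, p1, p2] [a, b, c]
    = (of_bool (a = p0) - of_bool (a = r0)) * (of_bool (b = p1) - of_bool (b = r1))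
      * (of_bool (c = p2) - of_bool (c = r2))"
  by (simp add: box_array_def numeral_3_eq_3)

lemma diag_sum_eq_of_bool:
  assumes "n > 0" "\<And>i. i \<in> {1..n} \<Longrightarrow> y (diag_index d n R i) = of_bool (Q \<and> i = 1)"
  shows "diag_sum d n y R = of_bool Q"
proof -
  have "diag_sum d n y R = (\<Sum>i=1..n. if i = 1 then of_bool Q else 0)"
    unfolding diag_sum_def by (intro sum.cong refl) (simp add: assms(2) del: One_nat_def)
  then show ?thesis using assms(1) by simp
qed

lemma subsets_lessThan_3:
  "R \<subseteq> {..<3::nat} \<Longrightarrow> R \<in> {{}, {0}, {1}, {2}} \<or> {..<3} - R \<in> {{}, {0}, {1}, {2}}"
proof -
  assume R: "R \<subseteq> {..<3}"
  have "{..<3::nat} = {0, 1, 2}" by auto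
  then have "R \<in> Pow {0, 1, 2}" using R by simp
  then show ?thesis unfolding \<open>{..<3::nat} = {0, 1, 2}\<close> Pow_insert Pow_empty by auto
qed

text \<open>On a diagonal every coordinate is i or n + 1 - i for a single i. For n \<ge> 5 the sets
  {1, n}, {2, n - 1}, {3, n - 2} are disjoint, so of the vertices of a box between a corner and
  [2, 2, 3] only the corner lies on a diagonal. No two of the four index sets are complementary, so
  among their diagonals it meets only its own.\<close>

lemma diagonal_pivots_3:
  assumes n: "n \<ge> 5"
  shows "diagonal_pivots 3 n [2, 2, 3] {{}, {0}, {1}, {2}}"
proof
  show "[2, 2, 3] \<in> hc_index 3 n" using n by (simp add: hc_index_def)
  show "[2, 2, 3] ! k \<noteq> (1::nat) \<and> [2, 2, 3] ! k \<noteq> n" if "k < 3" for k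
  proof -
    consider "k = 0" | "k = 1" | "k = 2" using \<open>k < 3\<close> by linarith
    then show ?thesis using n by cases auto
  qed
  show "diag_sum 3 n (box_array 3 [2, 2, 3] (diag_index 3 n R 1)) R' = of_bool (R = R')"
    if "R \<in> {{}, {0}, {1}, {2}}" "R' \<in> {{}, {0}, {1}, {2}}" for R R'
  proof (rule diag_sum_eq_of_bool)
    fix i assume i: "i \<in> {1..n}"
    from that(1) show "box_array 3 [2, 2, 3] (diag_index 3 n R 1) (diag_index 3 n R' i) = of_bool (R = R' \<and> i = 1)"
    proof (elim insertE emptyE)
      assume R: "R = {}"
      from that(2) show ?thesis unfolding R
        using n i by (elim insertE emptyE) (auto simp: diag_index_3 box_array_3)
    next
      assume R: "R = {0}"
      from that(2) show ?thesis unfolding R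
        using n i by (elim insertE emptyE) (auto simp: diag_index_3 box_array_3)
    next
      assume R: "R = {1}"
      from that(2) show ?thesis unfolding R
        using n i by (elim insertE emptyE) (auto simp: diag_index_3 box_array_3)
    next
      assume R: "R = {2}"
      from that(2) show ?thesis unfolding R
        using n i by (elim insertE emptyE) (auto simp: diag_index_3 box_array_3)
    qed
  qed (use n in simp)
  show "diag_sum 3 n y R = 0"
    if "\<And>R. R \<in> {{}, {0}, {1}, {2}} \<Longrightarrow> diag_sum 3 n y R = 0" "R \<subseteq> {..<3}" for y R
    using subsets_lessThan_3[OF that(2)] that(1) diag_sum_complement[OF that(2), of n y] by metis
qed auto

lemma axis_balanced_3_sums:
  assumes "axis_balanced 3 n y" "a \<in> {1..n}" "b \<in> {1..n}"
  shows "(\<Sum>i=1..n. y [i, a, b]) = 0" "(\<Sum>i=1..n. y [a, i, b]) = 0" "(\<Sum>i=1..n. y [a, b, i]) = 0"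
proof -
  have *: "(\<Sum>i=1..n. y (v[k := i])) = 0" if "v \<in> hc_index 3 n" "k < 3" for v k
    using assms(1) that unfolding axis_balanced_def by blast
  have "[a, b, b] \<in> hc_index 3 n" "[b, a, b] \<in> hc_index 3 n"
    using assms unfolding hc_index_3_iff by blast+
  then show "(\<Sum>i=1..n. y [i, a, b]) = 0" "(\<Sum>i=1..n. y [a, i, b]) = 0" "(\<Sum>i=1..n. y [a, b, i]) = 0"
    using *[of "[b, a, b]" 0] *[of "[a, b, b]" 1] *[of "[a, b, b]" 2] by simp_all
qed

lemma sum_1_4: "(\<Sum>i=1..4. f i) = f 1 + f 2 + f 3 + f (4 :: nat)"
  by (simp add: eval_nat_numeral sum.atLeast_Suc_atMost add.assoc)

text \<open>
  For \<open>n = 4\<close> the four diagonals are dependent: up to sign, the outer and inner entries of a balanced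
  array have equal sums along each axis, so the eight corners and the eight central entries, which are
  the cells of the four diagonals, cancel.
\<close>

lemma diag_sum_4_dependent:
  assumes y: "axis_balanced 3 4 y"
  shows "diag_sum 3 4 y {} = - (diag_sum 3 4 y {0} + diag_sum 3 4 y {1} + diag_sum 3 4 y {2})"
proof -
  note L = axis_balanced_3_sums[OF y, unfolded sum_1_4]
  have i: "1 \<in> {1..4::nat}" "2 \<in> {1..4::nat}" "3 \<in> {1..4::nat}" "4 \<in> {1..4::nat}" by auto
  note outer = L(3)[OF i(1) i(1)] L(3)[OF i(1) i(4)] L(3)[OF i(4) i(1)] L(3)[OF i(4) i(4)]
  note mixed = L(2)[OF i(1) i(2)] L(2)[OF i(1) i(3)] L(2)[OF i(4) i(2)] L(2)[OF i(4) i(3)]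
  note inner = L(1)[OF i(2) i(2)] L(1)[OF i(2) i(3)] L(1)[OF i(3) i(2)] L(1)[OF i(3) i(3)]
  show ?thesis
    unfolding diag_sum_def sum_1_4 diag_index_3 using outer mixed inner by simp
qed

text \<open>The inner coordinates 2 and 3 are reflections of each other, so every inner slice point
  lies on a diagonal. [2, 2, 2] lies only on that of {}, which is the one dropped as
  dependent.\<close>

lemma diagonal_pivots_4: "diagonal_pivots 3 4 [2, 2, 2] {{0}, {1}, {2}}"
proof
  show "[2, 2, 2] \<in> hc_index 3 4" by (simp add: hc_index_def)
  show "[2, 2, 2] ! k \<noteq> (1::nat) \<and> [2, 2, 2] ! k \<noteq> (4::nat)" if "k < 3" for k
  proof -
    consider "k = 0" | "k = 1" | "k = 2" using \<open>k < 3\<close> by linarith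
    then show ?thesis by cases auto
  qed
  show "diag_sum 3 4 (box_array 3 [2, 2, 2] (diag_index 3 4 R 1)) R' = of_bool (R = R')"
    if "R \<in> {{0}, {1}, {2}}" "R' \<in> {{0}, {1}, {2}}" for R R'
    unfolding diag_sum_def sum_1_4 using that
    by (elim insertE emptyE) (simp_all add: diag_index_3 box_array_3)
  show "diag_sum 3 4 y R = 0"
    if y: "axis_balanced 3 4 y" and zero: "\<And>R. R \<in> {{0}, {1}, {2}} \<Longrightarrow> diag_sum 3 4 y R = 0"
      and R: "R \<subseteq> {..<3}" for y R
  proof -
    have "diag_sum 3 4 y S = 0" if "S \<in> {{}, {0}, {1}, {2}}" for S
      using that diag_sum_4_dependent[OF y] zero by auto
    then show ?thesis
      using subsets_lessThan_3[OF R] diag_sum_complement[OF R, of 4 y] by metis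
  qed
qed auto

lemma quasipolynomial_MC:
  assumes "n \<ge> 5"
  shows "quasipolynomial_of_degree (\<lambda>s. of_nat (MC n s)) ((n - 1) ^ 3 - 4)"
proof -
  interpret diagonal_pivots 3 n "[2, 2, 3]" "{{}, {0}, {1}, {2}}"
    by (rule diagonal_pivots_3[OF assms])
  have "card {{}, {0}, {1}, {2 :: nat}} = 4" by simp
  then show ?thesis
    using quasipolynomial_of_degree_magic_arrays by (simp only: MC_def magic_arrays_def)
qed

lemma quasipolynomial_MC_4: "quasipolynomial_of_degree (\<lambda>s. of_nat (MC 4 s)) 24"
proof -
  interpret diagonal_pivots 3 4 "[2, 2, 2]" "{{0}, {1}, {2}}"
    by (rule diagonal_pivots_4)
  show ?thesis using quasipolynomial_of_degree_magic_arrays by (simp add: MC_def magic_arrays_def)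
qed

text \<open>The only inner slice point would be the centre, which lies on all four diagonals and
  spoils duality. The constituents are therefore taken from the formula: one quartic and two
  zeros.\<close>

lemma quasipolynomial_MC_3: "quasipolynomial_of_degree (\<lambda>s. of_nat (MC 3 s)) 4"
proof -
  define p :: "nat \<Rightarrow> complex poly" where
    "p i = (if i = 0 then [:1, 7 / 6, 25 / 36, 11 / 54, 11 / 324:] else 0)" for i
  have "of_nat (MC 3 s) = poly (p (s mod 3)) (of_nat s :: complex)" for s
  proof -
    have "of_nat (MC 3 s) = complex_of_real (real (MC 3 s))" by simp
    also have "\<dots> = poly (p (s mod 3)) (of_nat s)"
      unfolding MC_3_formula by (simp add: p_def mod_eq_0_iff_dvd algebra_simps power2_eq_square
        power3_eq_cube power4_eq_xxxx)
    finally show ?thesis .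
  qed
  then have "quasipolynomial_with (\<lambda>s. of_nat (MC 3 s)) 3 p"
    by (simp add: quasipolynomial_with_def)
  moreover have "4 = (MAX i\<in>{..<3::nat}. degree (p i))"
    by (simp add: lessThan_nat_numeral lessThan_Suc p_def numeral_3_eq_3)
  ultimately show ?thesis unfolding quasipolynomial_of_degree_def by blast
qed

section \<open>The generating function for side 3\<close>

definition fps_cubes :: "(nat \<Rightarrow> rat) \<Rightarrow> rat fps" where
  "fps_cubes h = Abs_fps (\<lambda>s. if 3 dvd s then h (s div 3) else 0)"

definition backward_difference :: "(nat \<Rightarrow> rat) \<Rightarrow> nat \<Rightarrow> rat" where
  "backward_difference h m = h m - (case m of 0 \<Rightarrow> 0 | Suc k \<Rightarrow> h k)"

text \<open>\<open>fps_cubes h\<close> is the generating function of h at X^3, so the factor 1 - X^3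
  takes backward differences, with value 0 at negative arguments.\<close>

lemma fps_cubes_mult: "fps_cubes h * (1 - fps_X ^ 3) = fps_cubes (backward_difference h)"
proof (rule fps_ext)
  fix s
  show "fps_nth (fps_cubes h * (1 - fps_X ^ 3)) s = fps_nth (fps_cubes (backward_difference h)) s"
  proof (cases "3 dvd s")
    case True
    then obtain m where s: "s = 3 * m" by auto
    have "3 * Suc k - 3 = 3 * k" for k by simp
    then show ?thesis
      by (cases m) (simp_all add: s fps_cubes_def backward_difference_def right_diff_distrib
        fps_X_power_mult_right_nth del: mult_Suc_right)
  next
    case False
    then have "\<not> 3 dvd s - 3" if "s \<ge> 3" using that by presburger
    then show ?thesis using False
      by (auto simp: fps_cubes_def right_diff_distrib fps_X_power_mult_right_nth)
  qed
qed

lemma fps_cubes_mult_power: "fps_cubes h * (1 - fps_X ^ 3) ^ k = fps_cubes ((backward_difference ^^ k) h)"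
proof (induction k)
  case (Suc k)
  have "fps_cubes h * (1 - fps_X ^ 3) ^ Suc k = (fps_cubes h * (1 - fps_X ^ 3) ^ k) * (1 - fps_X ^ 3)"
    by (simp only: power_Suc2 mult.assoc)
  then show ?case unfolding Suc.IH by (simp add: fps_cubes_mult)
qed simp

definition cube_count :: "nat \<Rightarrow> rat" where
  "cube_count m = (11 * of_nat m ^ 4 + 22 * of_nat m ^ 3 + 25 * of_nat m ^ 2 + 14 * of_nat m + 4) / 4"

lemma fps_MC_3: "Abs_fps (\<lambda>s. of_nat (MC 3 s)) = fps_cubes cube_count"
proof -
  have "of_nat (MC 3 s) = (if 3 dvd s then cube_count (s div 3) else 0)" for s
  proof (cases "3 dvd s")
    case True
    then obtain m where s: "s = 3 * m" by auto
    have "(of_nat (4 * MC 3 s) :: rat) = of_nat (11 * m ^ 4 + 22 * m ^ 3 + 25 * m ^ 2 + 14 * m + 4)"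
      unfolding s MC_3_multiple card_corner_deviations ..
    then show ?thesis by (simp add: s cube_count_def)
  qed (simp add: MC_3_not_multiple)
  then show ?thesis by (simp add: fps_cubes_def)
qed

text \<open>Fifth differences of a quartic vanish; only m < 5 involves the zeros put at negative
  arguments, and gives the coefficients of the numerator.\<close>

lemma backward_difference_cube_count:
  "(backward_difference ^^ 5) cube_count m
    = (if m = 0 \<or> m = 4 then 1 else if m = 1 \<or> m = 3 then 14 else if m = 2 then 36 else 0)"
proof -
  consider "m = 0" | "m = 1" | "m = 2" | "m = 3" | "m = 4" | k where "m = Suc (Suc (Suc (Suc (Suc k))))"
    by (metis One_nat_def Suc_1 numeral_3_eq_3 eval_nat_numeral(2) eval_nat_numeral(3) not0_implies_Suc semiring_norm(26,27))
  then show ?thesis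
    by cases (simp_all add: eval_nat_numeral backward_difference_def cube_count_def field_simps)
qed

lemma generating_function_MC_3:
  "Abs_fps (\<lambda>s. of_nat (MC 3 s) :: rat) =
     (fps_X ^ 12 + 14 * fps_X ^ 9 + 36 * fps_X ^ 6 + 14 * fps_X ^ 3 + 1) / (1 - fps_X ^ 3) ^ 5"
proof -
  let ?num = "fps_X ^ 12 + 14 * fps_X ^ 9 + 36 * fps_X ^ 6 + 14 * fps_X ^ 3 + 1 :: rat fps"
  have "fps_cubes cube_count * (1 - fps_X ^ 3) ^ 5 = ?num"
    unfolding fps_cubes_mult_power
    by (rule fps_ext) (auto simp: fps_cubes_def backward_difference_cube_count numeral_fps_const)
  moreover have "(1 - fps_X ^ 3 :: rat fps) ^ 5 \<noteq> 0"
  proof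
    assume "(1 - fps_X ^ 3 :: rat fps) ^ 5 = 0"
    then have "1 - fps_X ^ 3 = (0 :: rat fps)" by (rule power_eq_0_iff[THEN iffD1, THEN conjunct1])
    moreover have "fps_nth (1 - fps_X ^ 3 :: rat fps) 0 = 1" by (simp add: fps_X_power_nth)
    ultimately show False by (simp only: fps_zero_nth)
  qed
  ultimately show ?thesis
    unfolding fps_MC_3 by (metis nonzero_mult_div_cancel_right)
qed

lemma fps_cutoff_MC_3:
  "fps_cutoff 19 (Abs_fps (\<lambda>s. of_nat (MC 3 s) :: rat)) =
       1 + 19 * fps_X ^ 3 + 121 * fps_X ^ 6 + 439 * fps_X ^ 9 + 1171 * fps_X ^ 12
         + 2581 * fps_X ^ 15 + 4999 * fps_X ^ 18"
proof (rule fps_ext)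
  fix s :: nat
  have "s \<in> {0, 3, 6, 9, 12, 15, 18} \<or> \<not> (s < 19 \<and> 3 dvd s)" by simp presburger
  then consider "s = 0" | "s = 3" | "s = 6" | "s = 9" | "s = 12" | "s = 15" | "s = 18"
    | "\<not> (s < 19 \<and> 3 dvd s)" "s \<notin> {0, 3, 6, 9, 12, 15, 18}"
    by blast
  then show "fps_nth (fps_cutoff 19 (Abs_fps (\<lambda>s. of_nat (MC 3 s) :: rat))) s =
      fps_nth (1 + 19 * fps_X ^ 3 + 121 * fps_X ^ 6 + 439 * fps_X ^ 9 + 1171 * fps_X ^ 12
         + 2581 * fps_X ^ 15 + 4999 * fps_X ^ 18) s"
    unfolding fps_MC_3
    by cases (auto simp: fps_cubes_def cube_count_def numeral_fps_const)
qed

section \<open>Stochastic hypercubes of side 3 in dimension 4\<close>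

text \<open>With c the centre, successive lines give 1 - c, 1 + c, 3 - c and 5 + c as the sums of
  two, four, eight and sixteen entries, the last being the corners. The eight diagonals yield 8 = 8
  * c + (5 + c).\<close>

lemma magic_hypercube_4_3_center:
  fixes f :: "nat list \<Rightarrow> real"
  assumes f: "magic_hypercube 4 3 1 f"
  shows "f [2, 2, 2, 2] = 1 / 3"
proof -
  have line: "(\<Sum>i=1..3. f (v[k := i])) = 1" if "v \<in> hc_index 4 3" "k < 4" for v k
    using f that unfolding magic_hypercube_def semi_magic_hypercube_def by blast
  have v: "[a, b, c, d] \<in> hc_index 4 3" if "a \<in> {1, 2, 3}" "b \<in> {1, 2, 3}" "c \<in> {1, 2, 3}" "d \<in> {1, 2, 3}" for a b c d
    using that unfolding hc_index_def atLeastAtMost_1_3 by simp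
  have L1: "f [1, b, c, d] + f [2, b, c, d] + f [3, b, c, d] = 1"
    if "b \<in> {1, 2, 3}" "c \<in> {1, 2, 3}" "d \<in> {1, 2, 3}" for b c d
    using line[OF v[of 1 b c d], of 0] that unfolding sum_1_3 by simp
  have L2: "f [a, 1, c, d] + f [a, 2, c, d] + f [a, 3, c, d] = 1"
    if "a \<in> {1, 2, 3}" "c \<in> {1, 2, 3}" "d \<in> {1, 2, 3}" for a c d
    using line[OF v[of a 1 c d], of 1] that unfolding sum_1_3 by simp
  have L3: "f [a, b, 1, d] + f [a, b, 2, d] + f [a, b, 3, d] = 1"
    if "a \<in> {1, 2, 3}" "b \<in> {1, 2, 3}" "d \<in> {1, 2, 3}" for a b d
    using line[OF v[of a b 1 d], of 2] that unfolding sum_1_3 by simp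
  have L4: "f [a, b, c, 1] + f [a, b, c, 2] + f [a, b, c, 3] = 1"
    if "a \<in> {1, 2, 3}" "b \<in> {1, 2, 3}" "c \<in> {1, 2, 3}" for a b c
    using line[OF v[of a b c 1], of 3] that unfolding sum_1_3 by simp
  have diag: "f (diag_index 4 3 R 1) + f (diag_index 4 3 R 2) + f (diag_index 4 3 R 3) = 1"
    if "R \<subseteq> {..<4}" for R
  proof -
    have "(\<Sum>i=1..3. f (diag_index 4 3 R i)) = 1"
      using f that unfolding magic_hypercube_def by blast
    then show ?thesis by (simp only: sum_1_3)
  qed
  have diag_index: "diag_index 4 3 R i = [if 0 \<in> R then 4 - i else i, if 1 \<in> R then 4 - i else i,
     if 2 \<in> R then 4 - i else i, if 3 \<in> R then 4 - i else i]" for R i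
    by (simp add: diag_index_def eval_nat_numeral)
  have D: "f [1, 1, 1, 1] + f [2, 2, 2, 2] + f [3, 3, 3, 3] = 1" "f [3, 1, 1, 1] + f [2, 2, 2, 2] + f [1, 3, 3, 3] = 1"
    "f [1, 3, 1, 1] + f [2, 2, 2, 2] + f [3, 1, 3, 3] = 1" "f [1, 1, 3, 1] + f [2, 2, 2, 2] + f [3, 3, 1, 3] = 1"
    "f [1, 1, 1, 3] + f [2, 2, 2, 2] + f [3, 3, 3, 1] = 1" "f [3, 3, 1, 1] + f [2, 2, 2, 2] + f [1, 1, 3, 3] = 1"
    "f [3, 1, 3, 1] + f [2, 2, 2, 2] + f [1, 3, 1, 3] = 1" "f [3, 1, 1, 3] + f [2, 2, 2, 2] + f [1, 3, 3, 1] = 1"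
    using diag[of "{}"] diag[of "{0}"] diag[of "{1}"] diag[of "{2}"] diag[of "{3}"]
      diag[of "{0, 1}"] diag[of "{0, 2}"] diag[of "{0, 3}"] unfolding diag_index by simp_all
  have one: "f [1, 2, 2, 2] + f [3, 2, 2, 2] = 1 - f [2, 2, 2, 2]"
    using L1[of 2 2 2] by simp
  have two: "f [1, 1, 2, 2] + f [1, 3, 2, 2] + f [3, 1, 2, 2] + f [3, 3, 2, 2] = 1 + f [2, 2, 2, 2]"
    using L2[of 1 2 2] L2[of 3 2 2] one by simp
  have three: "f [1, 1, 1, 2] + f [1, 1, 3, 2] + f [1, 3, 1, 2] + f [1, 3, 3, 2]
      + f [3, 1, 1, 2] + f [3, 1, 3, 2] + f [3, 3, 1, 2] + f [3, 3, 3, 2] = 3 - f [2, 2, 2, 2]"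
    using L3[of 1 1 2] L3[of 1 3 2] L3[of 3 1 2] L3[of 3 3 2] two by simp
  show ?thesis
    using L4[of 1 1 1] L4[of 1 1 3] L4[of 1 3 1] L4[of 1 3 3]
      L4[of 3 1 1] L4[of 3 1 3] L4[of 3 3 1] L4[of 3 3 3] three D by simp
qed

section \<open>Compactness, convexity and a vertex\<close>

lemma stochastic_magic_hypercubes_eq:
  "stochastic_magic_hypercubes_3333 =
     (\<Inter>v\<in>hc_index 4 3. {x. 0 \<le> hc_entries x v})
     \<inter> (\<Inter>L\<in>hc_lines 4 3. {x. (\<Sum>i=1..3. hc_entries x (L i)) = 1})"
  unfolding stochastic_magic_hypercubes_3333_def magic_hypercube_iff_lines by blast

lemma continuous_on_hc_entries [continuous_intros]: "continuous_on S (\<lambda>x. hc_entries x v)"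
  unfolding hc_entries_def by (intro continuous_intros)

lemma closed_stochastic_magic_hypercubes: "closed stochastic_magic_hypercubes_3333"
  unfolding stochastic_magic_hypercubes_eq
  by (intro closed_Int closed_INT ballI closed_Collect_le closed_Collect_eq continuous_intros)

lemma hc_entries_lincomb: "hc_entries (a *\<^sub>R x + b *\<^sub>R y) v = a * hc_entries x v + b * hc_entries y v"
  by (simp add: hc_entries_def)

lemma convex_stochastic_magic_hypercubes: "convex stochastic_magic_hypercubes_3333"
  unfolding stochastic_magic_hypercubes_eq convex_def
  by (auto simp: hc_entries_lincomb sum.distrib sum_distrib_left[symmetric])

lemma norm_vec_le_sum: "norm x \<le> (\<Sum>i\<in>UNIV. norm (x $ i))"
  unfolding norm_vec_def by (rule L2_set_le_sum) simp

text \<open>Every coordinate of the space is an entry of the array, so that bounds on entries bound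
  the norm.\<close>

lemma hc_index_4_3_covers:
  fixes i j k l :: 3
  obtains v where "v \<in> hc_index 4 3" "\<And>x. hc_entries x v = x $ i $ j $ k $ l"
proof -
  have "\<exists>a\<in>{1..3::nat}. of_nat a = i" for i :: 3
    using exhaust_3[of i] by (auto intro: bexI[of _ 1] bexI[of _ 2] bexI[of _ 3])
  then obtain a b c d where "a \<in> {1..3::nat}" "b \<in> {1..3::nat}" "c \<in> {1..3::nat}" "d \<in> {1..3::nat}"
    "of_nat a = i" "of_nat b = j" "of_nat c = k" "of_nat d = l" by metis
  then show thesis
    by (intro that[of "[a, b, c, d]"]) (auto simp: hc_index_def hc_entries_def eval_nat_numeral)
qed

lemma stochastic_entry_le_1:
  assumes x: "x \<in> stochastic_magic_hypercubes_3333" and v: "v \<in> hc_index 4 3"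
  shows "\<bar>hc_entries x v\<bar> \<le> 1"
proof -
  have m: "magic_hypercube 4 3 1 (hc_entries x)" using x by (simp add: stochastic_magic_hypercubes_3333_def)
  have nonneg: "0 \<le> hc_entries x w" if "w \<in> hc_index 4 3" for w
    using m that unfolding magic_hypercube_iff_lines by blast
  have "length v = 4" "v ! 0 \<in> {1..3}" using v nth_mem[of 0 v] by (auto simp: hc_index_def simp del: nth_mem)
  then have "hc_entries x (v[0 := v ! 0]) \<le> (\<Sum>i=1..3. hc_entries x (v[0 := i]))"
    using nonneg hc_index_update[OF v] by (intro member_le_sum) auto
  also have "\<dots> = 1" using m v unfolding magic_hypercube_def semi_magic_hypercube_def by force
  finally show ?thesis using nonneg[OF v] by simp
qed

lemma bounded_stochastic_magic_hypercubes: "bounded stochastic_magic_hypercubes_3333"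
proof (rule boundedI)
  fix x assume x: "x \<in> stochastic_magic_hypercubes_3333"
  have entry: "norm (x $ i $ j $ k $ l) \<le> 1" for i j k l
    using stochastic_entry_le_1[OF x] hc_index_4_3_covers[of i j k l] by (metis real_norm_def)
  have 1: "norm (x $ i $ j $ k) \<le> 3" for i j k
    using norm_vec_le_sum[of "x $ i $ j $ k"] sum_bounded_above[of UNIV "\<lambda>l. norm (x $ i $ j $ k $ l)" 1] entry
    by simp
  have 2: "norm (x $ i $ j) \<le> 9" for i j
    using norm_vec_le_sum[of "x $ i $ j"] sum_bounded_above[of UNIV "\<lambda>k. norm (x $ i $ j $ k)" 3] 1
    by simp
  have 3: "norm (x $ i) \<le> 27" for i
    using norm_vec_le_sum[of "x $ i"] sum_bounded_above[of UNIV "\<lambda>j. norm (x $ i $ j)" 9] 2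
    by simp
  show "norm x \<le> 81"
    using norm_vec_le_sum[of x] sum_bounded_above[of UNIV "\<lambda>i. norm (x $ i)" 27] 3 by simp
qed

lemma stochastic_magic_hypercubes_nonempty: "stochastic_magic_hypercubes_3333 \<noteq> {}"
proof -
  have "(\<chi> i j k l. 1 / 3) \<in> stochastic_magic_hypercubes_3333"
    by (simp add: stochastic_magic_hypercubes_eq hc_entries_def)
  then show ?thesis by blast
qed

lemma not_integral_stochastic_magic_hypercubes: "\<not> integral_polytope stochastic_magic_hypercubes_3333"
proof
  assume integral: "integral_polytope stochastic_magic_hypercubes_3333"
  have "compact stochastic_magic_hypercubes_3333"
    using closed_stochastic_magic_hypercubes bounded_stochastic_magic_hypercubes
    by (simp add: compact_eq_bounded_closed)
  \<comment> \<open>No vertex is computed: a nonempty compact convex set has an extreme point, and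
    the centre entry is 1 / 3 throughout the polytope.\<close>
  then obtain x where x: "x extreme_point_of stochastic_magic_hypercubes_3333"
    using extreme_point_exists_convex convex_stochastic_magic_hypercubes stochastic_magic_hypercubes_nonempty
    by blast
  then have "magic_hypercube 4 3 1 (hc_entries x)"
    by (simp add: extreme_point_of_def stochastic_magic_hypercubes_3333_def)
  then have "x $ 2 $ 2 $ 2 $ 2 = 1 / 3"
    using magic_hypercube_4_3_center[of "hc_entries x"] by (simp add: hc_entries_def)
  moreover have "x \<bullet> axis 2 (axis 2 (axis 2 (axis 2 1))) = x $ 2 $ 2 $ 2 $ 2"
    by (simp add: inner_axis)
  moreover have "axis 2 (axis 2 (axis 2 (axis 2 1))) \<in> (Basis :: (real^3^3^3^3) set)"
    by (simp add: axis_in_Basis_iff)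
  ultimately have "1 / 3 \<in> (\<int> :: real set)"
    using integral x unfolding integral_polytope_def by metis
  then obtain k :: int where "1 / 3 = (of_int k :: real)" by (rule Ints_cases)
  then have "real_of_int (3 * k) = of_int 1" by simp
  then have "3 * k = 1" by (simp only: of_int_eq_iff)
  then show False by presburger
qed

theorem theorem0p2:
  "(\<forall>n\<ge>3. n \<noteq> 4 \<longrightarrow>
      quasipolynomial_of_degree (\<lambda>s. of_nat (MC n s)) ((n - 1) ^ 3 - 4))
   \<and> quasipolynomial_of_degree (\<lambda>s. of_nat (MC 4 s)) 24
   \<and> Abs_fps (\<lambda>s. of_nat (MC 3 s) :: rat) =
       (fps_X ^ 12 + 14 * fps_X ^ 9 + 36 * fps_X ^ 6 + 14 * fps_X ^ 3 + 1) / (1 - fps_X ^ 3) ^ 5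
   \<and> fps_cutoff 19 (Abs_fps (\<lambda>s. of_nat (MC 3 s) :: rat)) =
       1 + 19 * fps_X ^ 3 + 121 * fps_X ^ 6 + 439 * fps_X ^ 9 + 1171 * fps_X ^ 12
         + 2581 * fps_X ^ 15 + 4999 * fps_X ^ 18
   \<and> (\<forall>s. real (MC 3 s) =
        (if 3 dvd s
         then 11 / 324 * real s ^ 4 + 11 / 54 * real s ^ 3 + 25 / 36 * real s ^ 2 + 7 / 6 * real s + 1
         else 0))
   \<and> \<not> integral_polytope stochastic_magic_hypercubes_3333"
proof (intro conjI allI impI)
  fix n :: nat assume "n \<ge> 3" "n \<noteq> 4"
  then consider "n = 3" | "n \<ge> 5" by linarith
  then show "quasipolynomial_of_degree (\<lambda>s. of_nat (MC n s)) ((n - 1) ^ 3 - 4)"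
  proof cases
    case 1
    then show ?thesis using quasipolynomial_MC_3 by simp
  next
    case 2
    then show ?thesis by (rule quasipolynomial_MC)
  qed
qed (fact quasipolynomial_MC_4 generating_function_MC_3 fps_cutoff_MC_3 MC_3_formula
  not_integral_stochastic_magic_hypercubes)+

end
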